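(* For every $w\in W$, let $\lambda$ be the partition corresponding to $w(\Lambda_0)$, of length $l(\lambda)$. Then the normalized function $\widetilde\phi_w(\Lambda_0)$ is given by the determinant $$\widetilde\phi_w(\Lambda_0)=\det\Bigl(h^{(1-j)}_{\lambda_i-i+j}\Bigr)_{1\le i,j\le l(\lambda)},$$ where $h_k^{(j)}=\pi^j(\widetilde\phi_{k,0})$ and $\widetilde\phi_{k,0}$ is the normalized function for the single row partition $(k)$.
   Context: Field and group action. Let $K=\mathbf{C}(\alpha;f;\tau)$ be the field of rational functions in infinitely many independent variables $\alpha_i,f_i,\tau_i$ $(i\in\mathbf{Z})$. For each $i\in\mathbf{Z}$ let $s_i$ be the field automorphism of $K$ (over $\mathbf{C}$) with $s_i(\alpha_i)=-\alpha_i$, $s_i(\alpha_{i\pm1})=\alpha_{i\pm1}+\alpha_i$, $s_i(\alpha_j)=\alpha_j$ $(j\ne i,i\pm1)$; $s_i(f_i)=f_i$, $s_i(f_{i\pm1})=f_{i\pm1}\pm\alpha_i/f_i$, $s_i(f_j)=f_j$ $(j\neq i,i\pm1)$; $s_i(\tau_i)=f_i\tau_{i-1}\tau_{i+1}/\tau_i$, $s_i(\tau_j)=\tau_j$ $(j\ne i)$. These satisfy $s_i^2=1$, $(s_is_{i+1})^3=1$, $s_is_j=s_js_i$ $(j\ne i\pm1)$ and so define an action on $K$ of the Weyl group $W=W(A_\infty)$ (the Coxeter group with generators $s_i$, $i\in\mathbf Z$, and these relations). Let $\pi$ be the automorphism of $K$ with $\pi(\alpha_i)=\alpha_{i+1}$,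 $\pi(f_i)=f_{i+1}$, $\pi(\tau_i)=\tau_{i+1}$. Weights. $W$ also acts on the free $\mathbf Z$-module with basis $\Lambda_i$ $(i\in\mathbf{Z})$ by $s_i(\Lambda_i)=\Lambda_{i+1}+\Lambda_{i-1}-\Lambda_i$, $s_i(\Lambda_j)=\Lambda_j$ $(j\ne i)$. Put $v_i=\Lambda_i-\Lambda_{i-1}$; then $s_i$ swaps $v_i$ and $v_{i+1}$ and fixes the other $v_j$, so $W$ is identified with the group of finitely supported permutations of $\mathbf{Z}$, via $w(v_j)=v_{\sigma_w(j)}$. Formally $\Lambda_0=\sum_{j\le0}v_j$ and $w(\Lambda_0)=\sum_{i\in M}v_i$ with $M=\sigma_w(\mathbf{Z}_{\le0})$ (the Maya diagram); $M$ depends only on $w(\Lambda_0)$. In formulas in $K$, differences $v_a-v_b$ are read through $\alpha_i=v_i-v_{i+1}$, i.e. $v_a-v_b=\alpha_a+\dots+\alpha_{b-1}$ for $a<b$. Partitions. A partition $\lambda=(\lambda_1\ge\dots\ge\lambda_l>0)$ of length $l=l(\lambda)$ is identified with its Young diagram $Y=\{(i,j):1\le i\le l,\ 1\le j\le\lambda_i\}$; $\lambda'$ is the transposed partition. Its Frobenius symbol is $(I,J)=(\{i_1>\dots>i_k>0\},\{j_1>\dots>j_k\ge0\})$, $i_n=\lambda_n-n+1$, $j_n=\lambda'_n-n$, $k=\max\{n:\lambda_n\ge n\}$ ($I=J=\emptyset$ for the empty partition). The partition corresponding to $w(\Lambda_0)$ is the one whose Frobenius symbol satisfies $I=M\cap\mathbf{Z}_{>0}$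 and $-J=\mathbf{Z}_{\le0}\setminus M$ (that is, $M\cup(-J)=\mathbf{Z}_{\le0}\cup I$ as disjoint unions). Functions. For $w\in W$, $\phi_w(\Lambda_0)\in\mathbf{C}(\alpha;f)$ is defined by $w(\tau_0)=\phi_w(\Lambda_0)\prod_{i\in\mathbf{Z}}\tau_i^{m_i}$, where $m_i\in\{0,\pm1\}$ is the coefficient of $\Lambda_i$ in $w(\Lambda_0)$. With $\lambda=Y$ corresponding to $w(\Lambda_0)$, put $N_w=\prod_{(i,j)\in Y}\bigl(v_{j-\lambda'_j}-v_{\lambda_i-i+1}\bigr)$ and $\widetilde\phi_w(\Lambda_0)=\phi_w(\Lambda_0)/N_w$. Single rows. For $k\ge1$, $\widetilde\phi_{k,0}=\widetilde\phi_{s_{k-1}\cdots s_1s_0}(\Lambda_0)$ (here $s_{k-1}\cdots s_0(\Lambda_0)$ corresponds to the partition $(k)$), and $h_k^{(j)}=\pi^j(\widetilde\phi_{k,0})$ for $j\in\mathbf{Z}$. By convention $h_0^{(j)}=1$ and $h_k^{(j)}=0$ for $k<0$. The empty determinant is $1$. *)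

theory Defs
  imports
    "HOL-Library.Poly_Mapping"
    "HOL-Computational_Algebra.Fraction_Field"
    "Jordan_Normal_Form.Determinant"
begin

section \<open>The field of rational functions\<close>

datatype gvar = Alpha int | Fvar int | Tau int

text \<open>The linear order on the variables plays no role in the mathematics: it is only what the
  library needs to see that the polynomial ring below is an integral domain.\<close>

fun gvar_code :: "gvar \<Rightarrow> int" where
  "gvar_code (Alpha i) = 3 * i"
| "gvar_code (Fvar i) = 3 * i + 1"
| "gvar_code (Tau i) = 3 * i + 2"

lemma gvar_code_inject: "gvar_code x = gvar_code y \<longleftrightarrow> x = y"
  by (cases x; cases y; simp; presburger)

instantiation gvar :: linorder
begin
definition less_eq_gvar :: "gvar \<Rightarrow> gvar \<Rightarrow> bool" where
  "x \<le> y \<longleftrightarrow> gvar_code x \<le> gvar_code y"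
definition less_gvar :: "gvar \<Rightarrow> gvar \<Rightarrow> bool" where
  "x < y \<longleftrightarrow> gvar_code x < gvar_code y"
instance
  by standard (auto simp: less_eq_gvar_def less_gvar_def gvar_code_inject)
end

type_synonym gpoly = "(gvar \<Rightarrow>\<^sub>0 nat) \<Rightarrow>\<^sub>0 complex"
type_synonym ratfun = "gpoly fract"

definition const :: "complex \<Rightarrow> ratfun" where
  "const c = Fract (Poly_Mapping.single 0 c) 1"

definition var :: "gvar \<Rightarrow> ratfun" where
  "var x = Fract (Poly_Mapping.single (Poly_Mapping.single x 1) 1) 1"

abbreviation alpha :: "int \<Rightarrow> ratfun" where "alpha i \<equiv> var (Alpha i)"
abbreviation fvar :: "int \<Rightarrow> ratfun" where "fvar i \<equiv> var (Fvar i)"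
abbreviation tau :: "int \<Rightarrow> ratfun" where "tau i \<equiv> var (Tau i)"

definition eval_poly :: "(gvar \<Rightarrow> ratfun) \<Rightarrow> gpoly \<Rightarrow> ratfun" where
  "eval_poly \<sigma> p = (\<Sum>m\<in>Poly_Mapping.keys p.
     const (Poly_Mapping.lookup p m) * (\<Prod>x\<in>Poly_Mapping.keys m. \<sigma> x ^ Poly_Mapping.lookup m x))"

text \<open>Substitution of \<open>\<sigma>\<close> in a rational function. The value is determined
  (see \<open>subst_Fract\<close>) as soon as some representation has a denominator that does not
  vanish under \<open>\<sigma>\<close>; for the substitutions used below every rational function has one.\<close>

definition subst :: "(gvar \<Rightarrow> ratfun) \<Rightarrow> ratfun \<Rightarrow> ratfun" where
  "subst \<sigma> z = (THE y. \<exists>p q. z = Fract p q \<and> eval_poly \<sigma> q \<noteq> 0 \<and> y = eval_poly \<sigma> p / eval_poly \<sigma> q)"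

subsection \<open>Substitutions with an inverse are field homomorphisms\<close>

lemma const_hom [simp]:
  "const 0 = 0" "const 1 = 1" "const (a + b) = const a + const b" "const (a * b) = const a * const b"
  by (simp_all add: const_def Zero_fract_def One_fract_def single_add mult_single)

definition eval_mono :: "(gvar \<Rightarrow> ratfun) \<Rightarrow> (gvar \<Rightarrow>\<^sub>0 nat) \<Rightarrow> ratfun" where
  "eval_mono \<sigma> m = (\<Prod>x\<in>Poly_Mapping.keys m. \<sigma> x ^ Poly_Mapping.lookup m x)"

lemma eval_mono_superset:
  assumes "finite A" "Poly_Mapping.keys m \<subseteq> A"
  shows "eval_mono \<sigma> m = (\<Prod>x\<in>A. \<sigma> x ^ Poly_Mapping.lookup m x)"
  unfolding eval_mono_def using assms
  by (intro prod.mono_neutral_left) (auto simp: in_keys_iff)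

lemma eval_mono_0 [simp]: "eval_mono \<sigma> 0 = 1"
  by (simp add: eval_mono_def)

lemma eval_mono_single [simp]: "eval_mono \<sigma> (Poly_Mapping.single x 1) = \<sigma> x"
  by (simp add: eval_mono_def)

lemma eval_mono_add: "eval_mono \<sigma> (m + n) = eval_mono \<sigma> m * eval_mono \<sigma> n"
proof -
  let ?A = "Poly_Mapping.keys m \<union> Poly_Mapping.keys n"
  have "Poly_Mapping.keys (m + n) \<subseteq> ?A" by (rule Poly_Mapping.keys_add)
  then show ?thesis
    by (simp add: eval_mono_superset[of ?A] lookup_add power_add prod.distrib)
qed

lemma eval_poly_superset:
  assumes "finite A" "Poly_Mapping.keys p \<subseteq> A"
  shows "eval_poly \<sigma> p = (\<Sum>m\<in>A. const (Poly_Mapping.lookup p m) * eval_mono \<sigma> m)"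
  unfolding eval_poly_def eval_mono_def[symmetric] using assms
  by (intro sum.mono_neutral_left) (auto simp: in_keys_iff)

lemma eval_poly_0 [simp]: "eval_poly \<sigma> 0 = 0"
  by (simp add: eval_poly_def)

lemma eval_poly_add: "eval_poly \<sigma> (p + q) = eval_poly \<sigma> p + eval_poly \<sigma> q"
proof -
  let ?A = "Poly_Mapping.keys p \<union> Poly_Mapping.keys q"
  have "Poly_Mapping.keys (p + q) \<subseteq> ?A" by (rule Poly_Mapping.keys_add)
  then show ?thesis
    by (simp add: eval_poly_superset[of ?A] lookup_add distrib_right sum.distrib)
qed

lemma eval_poly_sum: "eval_poly \<sigma> (sum g A) = (\<Sum>x\<in>A. eval_poly \<sigma> (g x))"
  by (induction A rule: infinite_finite_induct) (simp_all add: eval_poly_add)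

lemma eval_poly_single: "eval_poly \<sigma> (Poly_Mapping.single m c) = const c * eval_mono \<sigma> m"
  by (subst eval_poly_superset[of "{m}"]) (auto simp: lookup_single)

lemma eval_poly_1 [simp]: "eval_poly \<sigma> 1 = 1"
  using eval_poly_single[of \<sigma> 0 1] by simp

lemma poly_sum_monomials:
  fixes p :: gpoly
  shows "p = (\<Sum>m\<in>Poly_Mapping.keys p. Poly_Mapping.single m (Poly_Mapping.lookup p m))"
  by (rule poly_mapping_eqI)
    (simp add: lookup_sum lookup_single when_def sum.delta' in_keys_iff)

lemma eval_poly_mult: "eval_poly \<sigma> (p * q) = eval_poly \<sigma> p * eval_poly \<sigma> q"
proof -
  have "eval_poly \<sigma> (p * q) = eval_poly \<sigma>
      ((\<Sum>m\<in>Poly_Mapping.keys p. Poly_Mapping.single m (Poly_Mapping.lookup p m)) *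
       (\<Sum>n\<in>Poly_Mapping.keys q. Poly_Mapping.single n (Poly_Mapping.lookup q n)))"
    using poly_sum_monomials[of p] poly_sum_monomials[of q] by simp
  also have "\<dots> = (\<Sum>m\<in>Poly_Mapping.keys p. const (Poly_Mapping.lookup p m) * eval_mono \<sigma> m) *
                 (\<Sum>n\<in>Poly_Mapping.keys q. const (Poly_Mapping.lookup q n) * eval_mono \<sigma> n)"
    by (simp add: sum_product mult_single eval_poly_sum eval_poly_single eval_mono_add mult_ac)
  finally show ?thesis
    by (simp add: eval_poly_def eval_mono_def)
qed

lemma subst_Fract:
  assumes "eval_poly \<sigma> q \<noteq> 0"
  shows "subst \<sigma> (Fract p q) = eval_poly \<sigma> p / eval_poly \<sigma> q"
  unfolding subst_def
proof (rule the_equality)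
  show "\<exists>p' q'. Fract p q = Fract p' q' \<and> eval_poly \<sigma> q' \<noteq> 0 \<and>
      eval_poly \<sigma> p / eval_poly \<sigma> q = eval_poly \<sigma> p' / eval_poly \<sigma> q'"
    using assms by blast
next
  fix y
  assume "\<exists>p' q'. Fract p q = Fract p' q' \<and> eval_poly \<sigma> q' \<noteq> 0 \<and> y = eval_poly \<sigma> p' / eval_poly \<sigma> q'"
  then obtain p' q' where *: "Fract p q = Fract p' q'" "eval_poly \<sigma> q' \<noteq> 0"
    "y = eval_poly \<sigma> p' / eval_poly \<sigma> q'" by blast
  have "q \<noteq> 0" "q' \<noteq> 0" using assms *(2) by auto
  then have "p * q' = p' * q" using *(1) by (simp add: eq_fract)
  then have "eval_poly \<sigma> p * eval_poly \<sigma> q' = eval_poly \<sigma> p' * eval_poly \<sigma> q"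
    by (metis eval_poly_mult)
  then show "y = eval_poly \<sigma> p / eval_poly \<sigma> q"
    using assms *(2,3) by (simp add: frac_eq_eq)
qed

text \<open>\<open>regular \<sigma> z\<close>: the substitution \<open>\<sigma>\<close> is defined at \<open>z\<close>.\<close>

definition regular :: "(gvar \<Rightarrow> ratfun) \<Rightarrow> ratfun \<Rightarrow> bool" where
  "regular \<sigma> z \<longleftrightarrow> (\<exists>p q. z = Fract p q \<and> eval_poly \<sigma> q \<noteq> 0)"

lemma regularE:
  assumes "regular \<sigma> z"
  obtains p q where "z = Fract p q" "q \<noteq> 0" "eval_poly \<sigma> q \<noteq> 0"
    "subst \<sigma> z = eval_poly \<sigma> p / eval_poly \<sigma> q"
  using assms subst_Fract unfolding regular_def by (metis eval_poly_0)

lemma eval_poly_one_nonzero: "eval_poly \<sigma> 1 \<noteq> 0"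
  by simp

lemma regular_const: "regular \<sigma> (const c)"
  unfolding regular_def const_def using eval_poly_one_nonzero by blast

lemma subst_const: "subst \<sigma> (const c) = const c"
  unfolding const_def[of c] by (simp add: subst_Fract eval_poly_single) (simp add: const_def)

lemma regular_var: "regular \<sigma> (var x)"
  unfolding regular_def var_def using eval_poly_one_nonzero by blast

lemma subst_var: "subst \<sigma> (var x) = \<sigma> x"
  unfolding var_def by (simp add: subst_Fract eval_poly_single del: One_nat_def)

lemma regular_add:
  assumes "regular \<sigma> y" "regular \<sigma> z"
  shows "regular \<sigma> (y + z)" "subst \<sigma> (y + z) = subst \<sigma> y + subst \<sigma> z"
proof -
  obtain p q where 1: "y = Fract p q" "q \<noteq> 0" "eval_poly \<sigma> q \<noteq> 0" "subst \<sigma> y = eval_poly \<sigma> p / eval_poly \<sigma> q"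
    using assms(1) by (rule regularE)
  obtain r s where 2: "z = Fract r s" "s \<noteq> 0" "eval_poly \<sigma> s \<noteq> 0" "subst \<sigma> z = eval_poly \<sigma> r / eval_poly \<sigma> s"
    using assms(2) by (rule regularE)
  have 3: "y + z = Fract (p * s + r * q) (q * s)" using 1 2 by simp
  have 4: "eval_poly \<sigma> (q * s) \<noteq> 0" using 1 2 by (simp add: eval_poly_mult)
  show "regular \<sigma> (y + z)" using 3 4 regular_def by blast
  show "subst \<sigma> (y + z) = subst \<sigma> y + subst \<sigma> z"
    unfolding 3 subst_Fract[OF 4] 1(4) 2(4) eval_poly_add eval_poly_mult
    using 1(3) 2(3) by (simp add: add_frac_eq)
qed

lemma regular_mult:
  assumes "regular \<sigma> y" "regular \<sigma> z"
  shows "regular \<sigma> (y * z)" "subst \<sigma> (y * z) = subst \<sigma> y * subst \<sigma> z"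
proof -
  obtain p q where 1: "y = Fract p q" "q \<noteq> 0" "eval_poly \<sigma> q \<noteq> 0" "subst \<sigma> y = eval_poly \<sigma> p / eval_poly \<sigma> q"
    using assms(1) by (rule regularE)
  obtain r s where 2: "z = Fract r s" "s \<noteq> 0" "eval_poly \<sigma> s \<noteq> 0" "subst \<sigma> z = eval_poly \<sigma> r / eval_poly \<sigma> s"
    using assms(2) by (rule regularE)
  have 3: "y * z = Fract (p * r) (q * s)" using 1 2 by simp
  have 4: "eval_poly \<sigma> (q * s) \<noteq> 0" using 1 2 by (simp add: eval_poly_mult)
  show "regular \<sigma> (y * z)" using 3 4 regular_def by blast
  show "subst \<sigma> (y * z) = subst \<sigma> y * subst \<sigma> z"
    unfolding 3 subst_Fract[OF 4] 1(4) 2(4) eval_poly_mult by simp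
qed

lemma regular_inverse:
  assumes "regular \<sigma> z" "subst \<sigma> z \<noteq> 0"
  shows "regular \<sigma> (inverse z)" "subst \<sigma> (inverse z) = inverse (subst \<sigma> z)"
proof -
  obtain p q where 1: "z = Fract p q" "q \<noteq> 0" "eval_poly \<sigma> q \<noteq> 0" "subst \<sigma> z = eval_poly \<sigma> p / eval_poly \<sigma> q"
    using assms(1) by (rule regularE)
  have 2: "eval_poly \<sigma> p \<noteq> 0" using 1(4) assms(2) by auto
  have 3: "inverse z = Fract q p" using 1 by simp
  show "regular \<sigma> (inverse z)" using 2 3 regular_def by blast
  show "subst \<sigma> (inverse z) = inverse (subst \<sigma> z)"
    unfolding 3 subst_Fract[OF 2] 1(4) by simp
qed

lemma regular_power:
  assumes "regular \<sigma> z"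
  shows "regular \<sigma> (z ^ n)" "subst \<sigma> (z ^ n) = subst \<sigma> z ^ n"
  using assms regular_const[of \<sigma> 1] subst_const[of \<sigma> 1]
  by (induction n) (auto simp: regular_mult)

lemma regular_prod:
  assumes "\<And>x. x \<in> A \<Longrightarrow> regular \<sigma> (g x)"
  shows "regular \<sigma> (prod g A) \<and> subst \<sigma> (prod g A) = (\<Prod>x\<in>A. subst \<sigma> (g x))"
  using assms regular_const[of \<sigma> 1] subst_const[of \<sigma> 1]
  by (induction A rule: infinite_finite_induct) (auto simp: regular_mult)

lemma regular_sum:
  assumes "\<And>x. x \<in> A \<Longrightarrow> regular \<sigma> (g x)"
  shows "regular \<sigma> (sum g A) \<and> subst \<sigma> (sum g A) = (\<Sum>x\<in>A. subst \<sigma> (g x))"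
  using assms regular_const[of \<sigma> 0] subst_const[of \<sigma> 0]
  by (induction A rule: infinite_finite_induct) (auto simp: regular_add)

lemma subst_eval_poly:
  assumes "\<And>x. regular \<rho> (\<sigma> x)"
  shows "subst \<rho> (eval_poly \<sigma> p) = eval_poly (\<lambda>x. subst \<rho> (\<sigma> x)) p"
proof -
  have mono: "regular \<rho> (eval_mono \<sigma> m) \<and> subst \<rho> (eval_mono \<sigma> m) = eval_mono (\<lambda>x. subst \<rho> (\<sigma> x)) m" for m
    unfolding eval_mono_def
    using regular_prod[of "Poly_Mapping.keys m" \<rho> "\<lambda>x. \<sigma> x ^ Poly_Mapping.lookup m x"]
      regular_power[OF assms] by simp
  show ?thesis
    unfolding eval_poly_def eval_mono_def[symmetric]
    using regular_sum[of "Poly_Mapping.keys p" \<rho> "\<lambda>m. const (Poly_Mapping.lookup p m) * eval_mono \<sigma> m"]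
    by (simp add: mono regular_mult regular_const subst_const)
qed

lemma const_sum: "const (sum g A) = (\<Sum>x\<in>A. const (g x))"
  by (induction A rule: infinite_finite_induct) simp_all

lemma Fract_power: "Fract (p::gpoly) 1 ^ n = Fract (p ^ n) 1"
  by (induction n) (simp_all add: One_fract_def)

lemma Fract_sum: "(\<Sum>x\<in>A. Fract (g x :: gpoly) 1) = Fract (sum g A) 1"
  by (induction A rule: infinite_finite_induct) (simp_all add: Zero_fract_def)

lemma single_var_power:
  "Poly_Mapping.single (Poly_Mapping.single x (1::nat)) (1::complex) ^ n =
   Poly_Mapping.single (Poly_Mapping.single x n) 1"
  by (induction n) (simp_all add: mult_single flip: single_add)

lemma Fract_mono_prod:
  "finite A \<Longrightarrow> (\<Prod>x\<in>A. Fract (Poly_Mapping.single (m x :: gvar \<Rightarrow>\<^sub>0 nat) (1::complex)) 1) =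
     Fract (Poly_Mapping.single (sum m A) 1) 1"
  by (induction A rule: finite_induct) (simp_all add: mult_single One_fract_def)

lemma mono_sum_singles:
  fixes m :: "gvar \<Rightarrow>\<^sub>0 nat"
  shows "(\<Sum>x\<in>Poly_Mapping.keys m. Poly_Mapping.single x (Poly_Mapping.lookup m x)) = m"
  by (rule poly_mapping_eqI)
    (simp add: lookup_sum lookup_single when_def sum.delta' in_keys_iff)

lemma eval_mono_var: "eval_mono var m = Fract (Poly_Mapping.single m 1) 1"
  by (simp add: eval_mono_def var_def Fract_power single_var_power Fract_mono_prod mono_sum_singles
      del: One_nat_def)

lemma eval_poly_var: "eval_poly var p = Fract p 1"
proof -
  have "eval_poly var p = (\<Sum>m\<in>Poly_Mapping.keys p. Fract (Poly_Mapping.single m (Poly_Mapping.lookup p m)) 1)"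
    unfolding eval_poly_def eval_mono_def[symmetric]
    by (simp add: eval_mono_var const_def mult_single)
  also have "\<dots> = Fract p 1"
    unfolding Fract_sum poly_sum_monomials[symmetric] ..
  finally show ?thesis .
qed

lemma Fract_eval: "q \<noteq> 0 \<Longrightarrow> Fract p q = eval_poly var p / eval_poly var q"
  by (simp add: eval_poly_var)

lemma subst_id: "subst var z = z"
proof (cases z)
  case (Fract p q)
  then show ?thesis by (simp add: subst_Fract Fract_eval[symmetric] eval_poly_var Zero_fract_def eq_fract)
qed

locale invertible_subst =
  fixes \<sigma> \<rho> :: "gvar \<Rightarrow> ratfun"
  assumes regular_image: "\<And>x. regular \<rho> (\<sigma> x)"
    and left_inverse: "\<And>x. subst \<rho> (\<sigma> x) = var x"
begin

lemma eval_poly_nonzero: "q \<noteq> 0 \<Longrightarrow> eval_poly \<sigma> q \<noteq> 0"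
proof
  assume "q \<noteq> 0" "eval_poly \<sigma> q = 0"
  have "Fract q 1 = eval_poly var q" by (simp add: eval_poly_var)
  also have "\<dots> = subst \<rho> (eval_poly \<sigma> q)"
    using subst_eval_poly[of \<rho> \<sigma> q, OF regular_image] by (simp add: left_inverse)
  also have "\<dots> = 0" using \<open>eval_poly \<sigma> q = 0\<close> subst_const[of \<rho> 0] by simp
  finally show False using \<open>q \<noteq> 0\<close> by (simp add: Zero_fract_def eq_fract)
qed

lemma all_regular: "regular \<sigma> z"
  by (cases z) (auto simp: regular_def dest: eval_poly_nonzero)

lemma field_hom_subst: "field_hom (subst \<sigma>)"
proof unfold_locales
  show "subst \<sigma> 0 = 0" "subst \<sigma> 1 = 1"
    using subst_const[of \<sigma> 0] subst_const[of \<sigma> 1] by simp_all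
qed (simp_all add: regular_add regular_mult all_regular)

end

lemma field_hom_ext:
  assumes "field_hom g" "field_hom h" "\<And>c. g (const c) = h (const c)" "\<And>x. g (var x) = h (var x)"
  shows "g = h"
proof
  interpret g: field_hom g by fact
  interpret h: field_hom h by fact
  have eval: "g (eval_poly var p) = h (eval_poly var p)" for p
    by (simp add: eval_poly_def g.hom_sum h.hom_sum g.hom_mult h.hom_mult g.hom_prod h.hom_prod
        g.hom_power h.hom_power assms(3,4))
  show "g z = h z" for z
    by (cases z) (simp add: Fract_eval g.hom_div h.hom_div eval)
qed

section \<open>The Weyl group\<close>

inductive cox_eq :: "int list \<Rightarrow> int list \<Rightarrow> bool" where
  cox_refl: "cox_eq x x"
| cox_sym: "cox_eq x y \<Longrightarrow> cox_eq y x"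
| cox_trans: "cox_eq x y \<Longrightarrow> cox_eq y z \<Longrightarrow> cox_eq x z"
| cox_square: "cox_eq (x @ [i, i] @ y) (x @ y)"
| cox_braid: "cox_eq (x @ [i, i + 1, i, i + 1, i, i + 1] @ y) (x @ y)"
| cox_commute: "j \<noteq> i + 1 \<Longrightarrow> j \<noteq> i - 1 \<Longrightarrow> cox_eq (x @ [i, j] @ y) (x @ [j, i] @ y)"

lemma equivp_cox_eq: "equivp cox_eq"
  by (rule equivpI) (auto intro!: reflpI sympI transpI intro: cox_eq.intros)

lemma cox_eq_context:
  assumes "cox_eq x y"
  shows "cox_eq (a @ x @ b) (a @ y @ b)"
  using assms
proof (induction rule: cox_eq.induct)
  case (cox_square x i y)
  then show ?case using cox_eq.cox_square[of "a @ x" i "y @ b"] by simp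
next
  case (cox_braid x i y)
  then show ?case using cox_eq.cox_braid[of "a @ x" i "y @ b"] by simp
next
  case (cox_commute j i x y)
  then show ?case using cox_eq.cox_commute[of j i "a @ x" "y @ b"] by simp
qed (blast intro: cox_eq.intros)+

lemma cox_eq_append: "cox_eq x x' \<Longrightarrow> cox_eq y y' \<Longrightarrow> cox_eq (x @ y) (x' @ y')"
  using cox_eq_context[of x x' "[]" y] cox_eq_context[of y y' x' "[]"] by (auto intro: cox_trans)

lemma cox_eq_foldr:
  fixes g :: "int \<Rightarrow> 'a \<Rightarrow> 'a"
  assumes "cox_eq x y"
    and square: "\<And>i. g i \<circ> g i = id"
    and braid: "\<And>i. g i \<circ> g (i + 1) \<circ> g i = g (i + 1) \<circ> g i \<circ> g (i + 1)"
    and commute: "\<And>i j. j \<noteq> i + 1 \<Longrightarrow> j \<noteq> i - 1 \<Longrightarrow> g i \<circ> g j = g j \<circ> g i"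
  shows "foldr g x = foldr g y"
  using assms(1)
proof (induction rule: cox_eq.induct)
  case (cox_square x i y)
  then show ?case using square[of i] by (simp add: fun_eq_iff)
next
  case (cox_braid x i y)
  have "g i (g (i + 1) (g i (g (i + 1) (g i (g (i + 1) z))))) = z" for z
    using square[of i] square[of "i + 1"] braid[of i] by (simp add: fun_eq_iff)
  then show ?case by (simp add: fun_eq_iff)
next
  case (cox_commute j i x y)
  then show ?case using commute[of j i] by (simp add: fun_eq_iff)
qed auto

text \<open>The Coxeter group: words in the generators modulo the congruence generated by the Coxeter
  relations.\<close>

quotient_type weyl = "int list" / cox_eq
  by (rule equivp_cox_eq)

instantiation weyl :: monoid_mult
begin
lift_definition one_weyl :: weyl is "[]" .
lift_definition times_weyl :: "weyl \<Rightarrow> weyl \<Rightarrow> weyl" is append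
  by (rule cox_eq_append)
instance
  by (standard; transfer; simp add: cox_refl)
end

lift_definition weyl_s :: "int \<Rightarrow> weyl" is "\<lambda>i. [i]" .

lemma weyl_s_square: "weyl_s i * weyl_s i = 1"
  by transfer (use cox_square[of "[]" _ "[]"] in simp)

lemma weyl_has_inverse: "\<exists>u. u * w = 1 \<and> w * u = (1 :: weyl)"
proof transfer
  fix x :: "int list"
  have 1: "cox_eq (rev x @ x) []" for x
  proof (induction x)
    case (Cons i x)
    have "cox_eq (rev x @ [i, i] @ x) (rev x @ x)" by (rule cox_square)
    with Cons show ?case by (auto intro: cox_trans)
  qed (simp add: cox_refl)
  from 1[of x] 1[of "rev x"] show "\<exists>u. cox_eq (u @ x) [] \<and> cox_eq (x @ u) []" by auto
qed

section \<open>The action on rational functions\<close>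

fun gen_image :: "int \<Rightarrow> gvar \<Rightarrow> ratfun" where
  "gen_image i (Alpha j) =
     (if j = i then - alpha i else if j = i + 1 \<or> j = i - 1 then alpha j + alpha i else alpha j)"
| "gen_image i (Fvar j) =
     (if j = i + 1 then fvar j + alpha i / fvar i
      else if j = i - 1 then fvar j - alpha i / fvar i else fvar j)"
| "gen_image i (Tau j) =
     (if j = i then fvar i * tau (i - 1) * tau (i + 1) / tau i else tau j)"

definition gen_act :: "int \<Rightarrow> ratfun \<Rightarrow> ratfun" where
  "gen_act i = subst (gen_image i)"

fun shift_image :: "int \<Rightarrow> gvar \<Rightarrow> ratfun" where
  "shift_image k (Alpha j) = alpha (j + k)"
| "shift_image k (Fvar j) = fvar (j + k)"
| "shift_image k (Tau j) = tau (j + k)"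

definition pi_act :: "ratfun \<Rightarrow> ratfun" where
  "pi_act = subst (shift_image 1)"

definition pi_power :: "int \<Rightarrow> ratfun \<Rightarrow> ratfun" where
  "pi_power j = (if 0 \<le> j then pi_act ^^ nat j else inv_into UNIV pi_act ^^ nat (- j))"

lemma var_nonzero [simp]: "var x \<noteq> 0"
proof -
  have "Poly_Mapping.single m (1::complex) \<noteq> 0" for m :: "gvar \<Rightarrow>\<^sub>0 nat"
    by (metis lookup_single_eq lookup_zero zero_neq_one)
  then show ?thesis by (simp add: var_def Zero_fract_def eq_fract)
qed

lemma regular_uminus:
  assumes "regular \<sigma> z"
  shows "regular \<sigma> (- z)" "subst \<sigma> (- z) = - subst \<sigma> z"
proof -
  have "const (-1) = - 1" by (simp add: const_def One_fract_def single_uminus)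
  then have "- z = const (-1) * z" "- subst \<sigma> z = const (-1) * subst \<sigma> z" by simp_all
  then show "regular \<sigma> (- z)" "subst \<sigma> (- z) = - subst \<sigma> z"
    using assms by (metis regular_mult(1) regular_const, metis regular_mult(2) regular_const subst_const)
qed

lemma regular_diff:
  assumes "regular \<sigma> y" "regular \<sigma> z"
  shows "regular \<sigma> (y - z)" "subst \<sigma> (y - z) = subst \<sigma> y - subst \<sigma> z"
  using assms by (simp_all only: diff_conv_add_uminus regular_add regular_uminus)

lemma regular_divide:
  assumes "regular \<sigma> y" "regular \<sigma> z" "subst \<sigma> z \<noteq> 0"
  shows "regular \<sigma> (y / z)" "subst \<sigma> (y / z) = subst \<sigma> y / subst \<sigma> z"
  using assms by (simp_all only: divide_inverse regular_mult regular_inverse not_False_eq_True)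

lemmas regular_intros = regular_var regular_const regular_add regular_mult regular_uminus
  regular_diff regular_divide subst_var subst_const

lemma invertible_gen: "invertible_subst (gen_image i) (gen_image i)"
proof
  fix x
  show "regular (gen_image i) (gen_image i x)"
    by (cases x) (simp_all add: regular_intros)
  show "subst (gen_image i) (gen_image i x) = var x"
    by (cases x) (auto simp: regular_intros)
qed

lemma field_hom_gen: "field_hom (gen_act i)"
  unfolding gen_act_def using invertible_subst.field_hom_subst[OF invertible_gen] .

lemma gen_act_const: "gen_act i (const c) = const c"
  and gen_act_var: "gen_act i (var x) = gen_image i x"
  by (simp_all add: gen_act_def subst_const subst_var)

lemma field_hom_comp: "field_hom g \<Longrightarrow> field_hom h \<Longrightarrow> field_hom (g \<circ> h)"
  for g h :: "ratfun \<Rightarrow> ratfun"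
proof -
  assume "field_hom g" "field_hom h"
  interpret g: field_hom g by fact
  interpret h: field_hom h by fact
  show ?thesis by unfold_locales (simp_all add: g.hom_add h.hom_add g.hom_mult h.hom_mult)
qed

lemma gen_act_square: "gen_act i \<circ> gen_act i = id"
proof (rule field_hom_ext)
  show "field_hom (gen_act i \<circ> gen_act i)" by (intro field_hom_comp field_hom_gen)
  show "field_hom (id :: ratfun \<Rightarrow> ratfun)" by unfold_locales auto
  show "(gen_act i \<circ> gen_act i) (var x) = id (var x)" for x
    using invertible_subst.left_inverse[OF invertible_gen] by (simp add: gen_act_var) (simp add: gen_act_def)
qed (simp add: gen_act_const)

interpretation gen_act: field_hom "gen_act i" for i
  by (rule field_hom_gen)

lemmas gen_act_simps = gen_act_var gen_act_const gen_act.hom_add gen_act.hom_mult gen_act.hom_minus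
  gen_act.hom_uminus gen_act.hom_div

lemma braid_nonzero:
  "fvar (i + 1) * fvar i + alpha i \<noteq> 0" "fvar i * fvar (i + 1) - alpha (i + 1) \<noteq> 0"
proof -
  have "gen_act i (fvar (i + 1)) \<noteq> 0" "gen_act (i + 1) (fvar i) \<noteq> 0" by simp_all
  then show "fvar (i + 1) * fvar i + alpha i \<noteq> 0" "fvar i * fvar (i + 1) - alpha (i + 1) \<noteq> 0"
    by (simp_all add: gen_act_var field_simps)
qed

lemma gen_act_braid:
  "gen_act i \<circ> gen_act (i + 1) \<circ> gen_act i = gen_act (i + 1) \<circ> gen_act i \<circ> gen_act (i + 1)"
proof (rule field_hom_ext)
  show "(gen_act i \<circ> gen_act (i + 1) \<circ> gen_act i) (var x) =
      (gen_act (i + 1) \<circ> gen_act i \<circ> gen_act (i + 1)) (var x)" for x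
  proof (cases x)
    case (Alpha j)
    consider "j = i - 1" | "j = i" | "j = i + 1" | "j = i + 2"
      | "j \<noteq> i - 1" "j \<noteq> i" "j \<noteq> i + 1" "j \<noteq> i + 2" by blast
    then show ?thesis unfolding Alpha by cases (simp_all add: gen_act_simps)
  next
    case (Fvar j)
    consider "j = i - 1" | "j = i" | "j = i + 1" | "j = i + 2"
      | "j \<noteq> i - 1" "j \<noteq> i" "j \<noteq> i + 1" "j \<noteq> i + 2" by blast
    then show ?thesis unfolding Fvar using braid_nonzero[of i]
      by cases (simp_all add: gen_act_simps divide_simps, simp_all add: algebra_simps)
  next
    case (Tau j)
    consider "j = i" | "j = i + 1" | "j \<noteq> i" "j \<noteq> i + 1" by blast
    then show ?thesis unfolding Tau
      by cases (simp_all add: gen_act_simps braid_nonzero divide_simps)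
  qed
qed (intro field_hom_comp field_hom_gen | simp add: gen_act_const)+

lemma gen_act_commute:
  assumes "j \<noteq> i + 1" "j \<noteq> i - 1"
  shows "gen_act i \<circ> gen_act j = gen_act j \<circ> gen_act i"
proof (rule field_hom_ext)
  show "(gen_act i \<circ> gen_act j) (var x) = (gen_act j \<circ> gen_act i) (var x)" for x
    using assms by (cases x) (auto simp: gen_act_simps add.commute)
qed (intro field_hom_comp field_hom_gen | simp add: gen_act_const)+

text \<open>The leftmost letter of a word acts last, so this is a left action.\<close>

lift_definition weyl_act :: "weyl \<Rightarrow> ratfun \<Rightarrow> ratfun" is "foldr gen_act"
  by (rule cox_eq_foldr) (assumption | rule gen_act_square gen_act_braid gen_act_commute)+

lemma weyl_act_one: "weyl_act 1 = id" and weyl_act_times: "weyl_act (u * w) = weyl_act u \<circ> weyl_act w"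
  and weyl_act_s: "weyl_act (weyl_s i) = gen_act i"
  by (transfer; simp add: fun_eq_iff)+

lemma invertible_shift: "invertible_subst (shift_image k) (shift_image (- k))"
proof
  show "regular (shift_image (- k)) (shift_image k x)"
    "subst (shift_image (- k)) (shift_image k x) = var x" for x
    by (cases x; simp add: regular_var subst_var)+
qed

lemma field_hom_shift: "field_hom (subst (shift_image k))"
  using invertible_subst.field_hom_subst[OF invertible_shift] .

lemma shift_inverse: "subst (shift_image (- k)) \<circ> subst (shift_image k) = id"
proof (rule field_hom_ext)
  show "field_hom (subst (shift_image (- k)) \<circ> subst (shift_image k))"
    by (intro field_hom_comp field_hom_shift)
  show "field_hom (id :: ratfun \<Rightarrow> ratfun)" by unfold_locales auto
  show "(subst (shift_image (- k)) \<circ> subst (shift_image k)) (var x) = id (var x)" for x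
    using invertible_subst.left_inverse[OF invertible_shift] by (simp add: subst_var)
qed (simp add: subst_const)

lemma bij_pi_act: "bij pi_act"
  unfolding pi_act_def
  by (rule o_bij[of "subst (shift_image (- 1))"])
    (use shift_inverse[of 1] shift_inverse[of "- 1"] in simp_all)

section \<open>The action on weights\<close>

text \<open>The weight \<open>\<Lambda>\<^sub>j\<close> is the basis element \<open>frag_of j\<close>.\<close>

definition gen_weight :: "int \<Rightarrow> (int \<Rightarrow>\<^sub>0 int) \<Rightarrow> (int \<Rightarrow>\<^sub>0 int)" where
  "gen_weight i = frag_extend
     (\<lambda>j. if j = i then frag_of (i + 1) + frag_of (i - 1) - frag_of i else frag_of j)"

lemma gen_weight_simps:
  "gen_weight i (frag_of j) = (if j = i then frag_of (i + 1) + frag_of (i - 1) - frag_of i else frag_of j)"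
  "gen_weight i (x + y) = gen_weight i x + gen_weight i y"
  "gen_weight i (x - y) = gen_weight i x - gen_weight i y"
  by (simp_all add: gen_weight_def frag_extend_add frag_extend_diff)

lemma weight_ext:
  fixes g h :: "(int \<Rightarrow>\<^sub>0 int) \<Rightarrow> (int \<Rightarrow>\<^sub>0 int)"
  assumes "\<And>x y. g (x - y) = g x - g y" "\<And>x y. h (x - y) = h x - h y"
    and "\<And>j. g (frag_of j) = h (frag_of j)"
  shows "g = h"
proof
  fix x
  have 0: "g 0 = 0" "h 0 = 0" using assms(1)[of 0 0] assms(2)[of 0 0] by simp_all
  show "g x = h x"
    by (rule frag_induction[of x UNIV]) (simp_all add: 0 assms)
qed

lift_definition weyl_weight :: "weyl \<Rightarrow> (int \<Rightarrow>\<^sub>0 int) \<Rightarrow> (int \<Rightarrow>\<^sub>0 int)" is "foldr gen_weight"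
proof (rule cox_eq_foldr)
  show "gen_weight i \<circ> gen_weight i = id" for i
    by (rule weight_ext) (auto simp: gen_weight_simps)
  show "gen_weight i \<circ> gen_weight (i + 1) \<circ> gen_weight i =
      gen_weight (i + 1) \<circ> gen_weight i \<circ> gen_weight (i + 1)" for i
    by (rule weight_ext) (auto simp: gen_weight_simps)
  show "gen_weight i \<circ> gen_weight j = gen_weight j \<circ> gen_weight i"
    if "j \<noteq> i + 1" "j \<noteq> i - 1" for i j
    using that by (intro weight_ext) (auto simp: gen_weight_simps)
qed

text \<open>\<open>v\<^sub>i = \<Lambda>\<^sub>i - \<Lambda>\<^sub>i\<^sub>-\<^sub>1\<close>\<close>

definition vwt :: "int \<Rightarrow> (int \<Rightarrow>\<^sub>0 int)" where
  "vwt i = frag_of i - frag_of (i - 1)"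

definition weyl_perm :: "weyl \<Rightarrow> int \<Rightarrow> int" where
  "weyl_perm w j = (THE k. weyl_weight w (vwt j) = vwt k)"

lemma vwt_inject: "vwt i = vwt j \<longleftrightarrow> i = j"
proof
  have lookup_vwt: "Poly_Mapping.lookup (vwt a) k = (if k = a then 1 else if k = a - 1 then -1 else 0)" for a k
    by (simp add: vwt_def lookup_minus lookup_single when_def)
  assume "vwt i = vwt j"
  then have "Poly_Mapping.lookup (vwt i) (max i j) = Poly_Mapping.lookup (vwt j) (max i j)" by simp
  then show "i = j" unfolding lookup_vwt by (simp add: max_def split: if_splits)
qed simp

lemma gen_weight_vwt:
  "gen_weight i (vwt j) = vwt (if j = i then i + 1 else if j = i + 1 then i else j)"
  by (auto simp: vwt_def gen_weight_simps)

lemma weyl_perm_unique: "\<exists>!k. weyl_weight w (vwt j) = vwt k"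
proof -
  have "\<exists>k. weyl_weight w (vwt j) = vwt k"
  proof transfer
    show "\<exists>k. foldr gen_weight x (vwt j) = vwt k" for x j
      by (induction x) (auto simp: gen_weight_vwt)
  qed
  then show ?thesis by (auto simp: vwt_inject)
qed

lemma weyl_perm: "weyl_weight w (vwt j) = vwt (weyl_perm w j)"
  unfolding weyl_perm_def using weyl_perm_unique by (rule theI')

text \<open>The Maya diagram \<open>M\<close> of \<open>w(\<Lambda>\<^sub>0)\<close>.\<close>

definition maya :: "weyl \<Rightarrow> int set" where
  "maya w = weyl_perm w ` {..0}"

section \<open>Partitions\<close>

definition is_partition :: "nat list \<Rightarrow> bool" where
  "is_partition lam \<longleftrightarrow> sorted_wrt (\<ge>) lam \<and> (\<forall>x\<in>set lam. 0 < x)"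

text \<open>Parts, columns and cells are numbered from 1; \<open>conj_part lam\<close> is the transposed partition.\<close>

definition part :: "nat list \<Rightarrow> nat \<Rightarrow> nat" where
  "part lam i = (if 1 \<le> i \<and> i \<le> length lam then lam ! (i - 1) else 0)"

definition conj_part :: "nat list \<Rightarrow> nat \<Rightarrow> nat" where
  "conj_part lam j = card {i \<in> {1..length lam}. j \<le> part lam i}"

definition diagram :: "nat list \<Rightarrow> (nat \<times> nat) set" where
  "diagram lam = {(i, j). 1 \<le> i \<and> i \<le> length lam \<and> 1 \<le> j \<and> j \<le> part lam i}"

definition frobenius_rank :: "nat list \<Rightarrow> nat" where
  "frobenius_rank lam = Max (insert 0 {n \<in> {1..length lam}. n \<le> part lam n})"

text \<open>In the Frobenius symbol \<open>(I, J)\<close> used here the diagonal cell is counted in \<open>I\<close> only, so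
  \<open>I\<close> consists of positive and \<open>J\<close> of nonnegative integers.\<close>

definition frobenius_I :: "nat list \<Rightarrow> int set" where
  "frobenius_I lam = (\<lambda>n. int (part lam n) - int n + 1) ` {1..frobenius_rank lam}"

definition frobenius_J :: "nat list \<Rightarrow> int set" where
  "frobenius_J lam = (\<lambda>n. int (conj_part lam n) - int n) ` {1..frobenius_rank lam}"

definition partition_of :: "weyl \<Rightarrow> nat list" where
  "partition_of w = (THE lam. is_partition lam \<and>
     frobenius_I lam = maya w \<inter> {0<..} \<and> uminus ` frobenius_J lam = {..0} - maya w)"

section \<open>The functions\<close>

definition phi :: "weyl \<Rightarrow> ratfun" where
  "phi w = weyl_act w (tau 0) /
     (let \<mu> = weyl_weight w (frag_of 0)
      in \<Prod>i\<in>Poly_Mapping.keys \<mu>. tau i powi Poly_Mapping.lookup \<mu> i)"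

text \<open>\<open>v_diff a b\<close> is \<open>v\<^sub>a - v\<^sub>b\<close>, read in the field through \<open>\<alpha>\<^sub>i = v\<^sub>i - v\<^sub>i\<^sub>+\<^sub>1\<close>.\<close>

definition v_diff :: "int \<Rightarrow> int \<Rightarrow> ratfun" where
  "v_diff a b = (\<Sum>i\<in>{a..<b}. alpha i) - (\<Sum>i\<in>{b..<a}. alpha i)"

definition norm_factor :: "nat list \<Rightarrow> ratfun" where
  "norm_factor lam = (\<Prod>(i, j)\<in>diagram lam.
     v_diff (int j - int (conj_part lam j)) (int (part lam i) - int i + 1))"

definition phi_norm :: "weyl \<Rightarrow> ratfun" where
  "phi_norm w = phi w / norm_factor (partition_of w)"

text \<open>\<open>row_elt k\<close> is \<open>s\<^sub>k\<^sub>-\<^sub>1 \<cdots> s\<^sub>1 s\<^sub>0\<close>, and \<open>h_row j k\<close> is \<open>h\<^sub>k\<close> with upper index \<open>j\<close>.\<close>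

definition row_elt :: "nat \<Rightarrow> weyl" where
  "row_elt k = prod_list (map (\<lambda>i. weyl_s (int i)) (rev [0..<k]))"

definition h_row :: "int \<Rightarrow> int \<Rightarrow> ratfun" where
  "h_row j k = (if k < 0 then 0 else if k = 0 then 1 else pi_power j (phi_norm (row_elt (nat k))))"

end

theory Submission
  imports Defs
begin

text \<open>Let \<open>H\<close> be the upper unitriangular matrix with entries \<open>H\<^sub>b\<^sub>a = h\<close> with lower index \<open>a - b\<close>
  and upper index \<open>b\<close>, and scale column \<open>a\<close> by \<open>\<tau>\<^sub>a / \<tau>\<^sub>a\<^sub>-\<^sub>1\<close>. The generator \<open>s\<^sub>i\<close> acts on the result
  by subtracting \<open>\<alpha>\<^sub>i / f\<^sub>i\<close> times row \<open>i\<close> from row \<open>i + 1\<close> and by exchanging the columns \<open>i\<close> and \<open>i + 1\<close> up to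
  scalars, which become \<open>1\<close> after column \<open>a\<close> is divided by the product of the \<open>v\<^sub>q - v\<^sub>a\<close> over
  \<open>a < q \<le> n\<close>. The row operation does not change minors on the rows
  \<open>1 - n, \<dots>, 0\<close>, so by induction along a word \<open>w(\<tau>\<^sub>0)\<close> is, up to explicit factors, the minor on these
  rows and the columns \<open>\<sigma>(1 - n), \<dots>, \<sigma>(0)\<close>, where \<open>\<sigma>\<close> is the permutation of \<open>w\<close>. These columns are the elements
  of the Maya diagram above \<open>- n\<close>, that is, the numbers \<open>\<lambda>\<^sub>i - i + 1\<close>; sorting them produces a sign that cancels
  against a Vandermonde product, and what remains of the explicit factors is \<open>N\<^sub>w\<close>.\<close>

abbreviation simple_swap :: "int \<Rightarrow> int \<Rightarrow> int" where
  "simple_swap i \<equiv> transpose i (i + 1)"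

lemma simple_swap_apply:
  "simple_swap i j = (if j = i then i + 1 else if j = i + 1 then i else j)"
  by (simp add: transpose_def)

section \<open>Row functions\<close>

text \<open>These will turn out to be \<open>h\<close> with lower index \<open>k\<close> and upper
  index \<open>b\<close>. They are studied in recursive form first, because the identification in
  \<open>h_row_eq_row_mat\<close> comes from the determinant formula for a single row.\<close>

fun row_fun :: "int \<Rightarrow> nat \<Rightarrow> ratfun" where
  "row_fun b 0 = 1"
| "row_fun b (Suc k) = fvar (b + int k) / alpha (b + int k) * gen_act (b + int k) (row_fun b k)"

lemma gen_act_involution: "gen_act i (gen_act i z) = z"
  using gen_act_square[of i] by (simp add: fun_eq_iff)

lemma gen_act_commute_apply:
  "j \<noteq> i + 1 \<Longrightarrow> j \<noteq> i - 1 \<Longrightarrow> gen_act i (gen_act j z) = gen_act j (gen_act i z)"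
  using gen_act_commute[of j i] by (simp add: fun_eq_iff)

lemma gen_act_braid_apply:
  "gen_act i (gen_act (i + 1) (gen_act i z)) = gen_act (i + 1) (gen_act i (gen_act (i + 1) z))"
  using gen_act_braid[of i] by (simp add: fun_eq_iff)

lemma alpha_sum_nonzero: "alpha i + alpha (i + 1) \<noteq> 0"
proof -
  have "gen_act i (alpha (i + 1)) \<noteq> 0" by simp
  then show ?thesis by (simp add: gen_act_var add.commute)
qed

text \<open>Only generators and variables with indices from \<open>b\<close> to
  \<open>b + k - 1\<close> enter \<open>row_fun b k\<close>, and none of these equals or neighbours
  \<open>i\<close>.\<close>

lemma gen_act_row_fun_outside:
  "i < b - 1 \<or> i > b + int k \<Longrightarrow> gen_act i (row_fun b k) = row_fun b k"
proof (induction k)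
  case (Suc k)
  then have "gen_act i (gen_act (b + int k) (row_fun b k)) = gen_act (b + int k) (row_fun b k)"
    by (subst gen_act_commute_apply) auto
  moreover have "b + int k \<noteq> i" "b + int k \<noteq> i + 1" "b + int k \<noteq> i - 1" using Suc.prems by auto
  ultimately show ?case by (simp add: gen_act_simps)
qed simp

text \<open>Only the step in which the generator \<open>i + 1\<close> enters needs an argument, the
  braid relation; all later generators commute with \<open>i\<close>.\<close>

lemma gen_act_row_fun_inside:
  "b \<le> i \<Longrightarrow> i + 2 \<le> b + int k \<Longrightarrow> gen_act i (row_fun b k) = row_fun b k"
proof (induction k)
  case (Suc k)
  show ?case
  proof (cases "i + 1 = b + int k")
    case True
    then obtain m where k: "k = Suc m" using Suc.prems by (cases k) auto
    have i: "b + int m = i" "b + int k = i + 1" using True k by auto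
    have fixed: "gen_act (i + 1) (row_fun b m) = row_fun b m"
      by (rule gen_act_row_fun_outside) (simp add: flip: i(1))
    \<comment> \<open>The braid relation moves a generator \<open>i + 1\<close> to the inside, where
      \<open>fixed\<close> absorbs it; so \<open>z\<close> is invariant.\<close>
    define z where "z = gen_act (i + 1) (gen_act i (row_fun b m))"
    have z: "gen_act i z = z"
      unfolding z_def by (simp add: gen_act_braid_apply fixed)
    \<comment> \<open>The factor that two steps of the recursion leave in front of \<open>z\<close>;
      its numerator and its denominator are each invariant under \<open>i\<close>.\<close>
    define c where "c = (fvar i * fvar (i + 1) - alpha (i + 1)) / (alpha (i + 1) * (alpha i + alpha (i + 1)))"
    have "row_fun b k = fvar i / alpha i * gen_act i (row_fun b m)"
      by (simp only: k row_fun.simps i)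
    then have "row_fun b (Suc k) = fvar (i + 1) / alpha (i + 1)
        * (gen_act (i + 1) (fvar i) / gen_act (i + 1) (alpha i) * z)"
      by (simp only: row_fun.simps i z_def gen_act.hom_mult gen_act.hom_div)
    also have "\<dots> = c * z"
      using alpha_sum_nonzero[of i] by (simp add: c_def gen_act_var divide_simps)
    finally have eq: "row_fun b (Suc k) = c * z" .
    have c: "gen_act i c = c"
      using alpha_sum_nonzero[of i]
      by (simp add: c_def gen_act_simps divide_simps) (simp add: algebra_simps)
    show ?thesis unfolding eq gen_act.hom_mult z c ..
  next
    case False
    then have le: "i + 2 \<le> b + int k" using Suc.prems by simp
    then have "gen_act i (gen_act (b + int k) (row_fun b k)) = gen_act (b + int k) (row_fun b k)"
      by (subst gen_act_commute_apply) (auto simp: Suc.IH Suc.prems)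
    then show ?thesis using le by (simp add: gen_act_simps)
  qed
qed simp

text \<open>This relation makes \<open>s\<^sub>i\<close> act on the matrix \<open>tau_mat\<close> below by a row operation.\<close>

lemma gen_act_row_fun_below:
  "gen_act i (row_fun (i + 1) (Suc k)) =
     row_fun (i + 1) (Suc k) - alpha i / fvar i * row_fun i (Suc (Suc k))"
proof (induction k)
  case 0
  show ?case
    using alpha_sum_nonzero[of i]
    by (simp add: gen_act_simps divide_simps) (simp add: algebra_simps)
next
  case (Suc k)
  \<comment> \<open>The index of the outermost generator in both row functions. It commutes with
    \<open>i\<close>, so the relation for \<open>k\<close> carries over.\<close>
  define j where "j = i + 2 + int k"
  have far: "j \<noteq> i" "j \<noteq> i + 1" "j \<noteq> i - 1" by (simp_all add: j_def)
  have rec: "row_fun (i + 1) (Suc (Suc k)) = fvar j / alpha j * gen_act j (row_fun (i + 1) (Suc k))"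
    "row_fun i (Suc (Suc (Suc k))) = fvar j / alpha j * gen_act j (row_fun i (Suc (Suc k)))"
    by (simp_all only: row_fun.simps(2)[of _ "Suc k"] row_fun.simps(2)[of _ "Suc (Suc k)"])
      (simp_all add: j_def algebra_simps)
  have "gen_act i (gen_act j (row_fun (i + 1) (Suc k))) =
      gen_act j (row_fun (i + 1) (Suc k)) - alpha i / fvar i * gen_act j (row_fun i (Suc (Suc k)))"
    using far
    by (subst gen_act_commute_apply) (auto simp del: row_fun.simps simp: Suc.IH gen_act_simps)
  moreover have "gen_act i (fvar j / alpha j) = fvar j / alpha j" using far by (simp add: gen_act_simps)
  ultimately show ?case
    unfolding rec gen_act.hom_mult by (simp add: right_diff_distrib mult.commute mult.left_commute del: row_fun.simps)
qed

section \<open>The matrix of row functions\<close>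

definition row_mat :: "int \<Rightarrow> int \<Rightarrow> ratfun" where
  "row_mat b a = (if a < b then 0 else row_fun b (nat (a - b)))"

lemma row_mat_below: "a < b \<Longrightarrow> row_mat b a = 0"
  by (simp add: row_mat_def)

lemma row_mat_diag: "row_mat b b = 1"
  by (simp add: row_mat_def)

lemma row_mat_superdiag: "row_mat b (b + 1) = fvar b / alpha b"
  by (simp add: row_mat_def)

lemma gen_act_row_mat_fixed:
  assumes "a \<noteq> i" "a \<noteq> i + 1" "b \<noteq> i + 1"
  shows "gen_act i (row_mat b a) = row_mat b a"
proof (cases "b \<le> a")
  case True
  consider "i < b - 1 \<or> i > b + int (nat (a - b))" | "b \<le> i" "i + 2 \<le> b + int (nat (a - b))"
    using assms True by fastforce
  then show ?thesis
    by cases (use True in \<open>simp_all add: row_mat_def gen_act_row_fun_outside gen_act_row_fun_inside\<close>)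
qed (simp add: row_mat_below)

text \<open>The recursion of \<open>row_fun\<close>, solved for the image. Row \<open>i + 1\<close>
  is excluded because its entry in column \<open>i\<close> is zero while that in column
  \<open>i + 1\<close> is one.\<close>

lemma gen_act_row_mat_left:
  assumes "b \<noteq> i + 1"
  shows "gen_act i (row_mat b i) = alpha i / fvar i * row_mat b (i + 1)"
proof (cases "b \<le> i")
  case True
  then have "nat (i + 1 - b) = Suc (nat (i - b))" by simp
  then show ?thesis using True by (simp add: row_mat_def)
next
  case False
  then show ?thesis using assms by (simp add: row_mat_below)
qed

lemma gen_act_row_mat_right:
  assumes "b \<noteq> i + 1"
  shows "gen_act i (row_mat b (i + 1)) = - (fvar i / alpha i) * row_mat b i"
proof -
  have "row_mat b i = - (alpha i / fvar i) * gen_act i (row_mat b (i + 1))"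
    using arg_cong[OF gen_act_row_mat_left[OF assms], of "gen_act i"]
    by (simp add: gen_act_involution gen_act_simps)
  then show ?thesis by simp
qed

lemma gen_act_row_mat_next:
  assumes "a \<noteq> i" "a \<noteq> i + 1"
  shows "gen_act i (row_mat (i + 1) a) = row_mat (i + 1) a - alpha i / fvar i * row_mat i a"
proof (cases "a < i")
  case False
  define k where "k = nat (a - i - 2)"
  have "a = i + 2 + int k" using assms False by (simp add: k_def)
  then have "nat (a - (i + 1)) = Suc k" "nat (a - i) = Suc (Suc k)" by auto
  then show ?thesis
    using False assms gen_act_row_fun_below[of i k] by (simp add: row_mat_def)
qed (simp add: row_mat_below)

text \<open>\<open>tau a / tau (a - 1)\<close> is the monomial of the weight \<open>vwt a\<close>.
  The generator \<open>i\<close> exchanges the monomials for \<open>i\<close> and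
  \<open>i + 1\<close> up to \<open>fvar i\<close> or its inverse, which cancels the
  \<open>fvar i\<close> in the column relations of \<open>row_mat\<close>.\<close>

definition tau_mat :: "int \<Rightarrow> int \<Rightarrow> ratfun" where
  "tau_mat b a = row_mat b a * tau a / tau (a - 1)"

text \<open>\<open>L\<close> is the matrix after the row operation. In row \<open>i + 1\<close> the
  operation clears column \<open>i + 1\<close>, because of \<open>row_mat_superdiag\<close>, and
  fills column \<open>i\<close>, as the exchange of columns requires.\<close>

lemma gen_act_tau_mat:
  fixes i :: int
  defines "L \<equiv> \<lambda>b a. tau_mat b a - (if b = i + 1 then alpha i / fvar i * tau_mat i a else 0)"
  shows "gen_act i (tau_mat b a) =
    (if a = i then alpha i * L b (i + 1) else if a = i + 1 then - (L b i / alpha i) else L b a)"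
proof (cases "b = i + 1")
  case True
  consider "a = i" | "a = i + 1" | "a \<noteq> i" "a \<noteq> i + 1" by blast
  then show ?thesis unfolding True
    by cases (simp_all add: L_def tau_mat_def gen_act_simps row_mat_below row_mat_diag
        row_mat_superdiag gen_act_row_mat_next left_diff_distrib diff_divide_distrib)
next
  case False
  then show ?thesis
    by (auto simp: L_def tau_mat_def gen_act_simps gen_act_row_mat_fixed gen_act_row_mat_left gen_act_row_mat_right)
qed

section \<open>Differences of the \<open>v\<^sub>i\<close>\<close>

lemma v_diff_self [simp]: "v_diff a a = 0"
  by (simp add: v_diff_def)

lemma v_diff_swap: "v_diff a b = - v_diff b a"
  by (simp add: v_diff_def)

lemma v_diff_succ: "v_diff (a + 1) b = v_diff a b - alpha a"
proof (cases "a < b")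
  case True
  then have "{a..<b} = insert a {a + 1..<b}" by auto
  then show ?thesis using True by (simp add: v_diff_def)
next
  case False
  then have "{b..<a + 1} = insert a {b..<a}" by auto
  then show ?thesis using False by (simp add: v_diff_def)
qed

lemma v_diff_step: "v_diff a (a + 1) = alpha a"
  using v_diff_succ[of a a] v_diff_swap[of a "a + 1"] by simp

lemma v_diff_trans: "v_diff a b + v_diff b c = v_diff a c"
proof (induction a rule: int_induct[where k = b])
  case (step2 i)
  have "v_diff (i - 1) x = v_diff i x + alpha (i - 1)" for x using v_diff_succ[of "i - 1" x] by simp
  then show ?case using step2 by (simp add: add.commute add.left_commute flip: step2(2))
qed (simp_all add: v_diff_succ algebra_simps)

text \<open>By additivity the images of the consecutive differences \<open>alpha a\<close> suffice,
  and these change only for \<open>a\<close> equal to \<open>i - 1\<close>, \<open>i\<close> or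
  \<open>i + 1\<close>.\<close>

lemma gen_act_v_diff: "gen_act i (v_diff a b) = v_diff (simple_swap i a) (simple_swap i b)"
proof -
  have step: "gen_act i (alpha a) = v_diff (simple_swap i a) (simple_swap i (a + 1))" for a
  proof -
    consider "a = i" | "a = i + 1" | "a = i - 1" | "a \<noteq> i" "a \<noteq> i + 1" "a \<noteq> i - 1" by blast
    then show ?thesis
    proof cases
      case 2
      have "v_diff i (i + 1 + 1) = alpha i + alpha (i + 1)"
        using v_diff_trans[of i "i + 1" "i + 1 + 1"] by (simp only: v_diff_step)
      then show ?thesis unfolding 2 by (simp add: gen_act_var simple_swap_apply add.commute)
    next
      case 3
      have "v_diff (i - 1) (i + 1) = alpha (i - 1) + alpha i"
        using v_diff_trans[of "i - 1" i "i + 1"] v_diff_step[of "i - 1"] v_diff_step[of i] by simp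
      then show ?thesis unfolding 3 by (simp add: gen_act_var simple_swap_apply)
    qed (auto simp: gen_act_var simple_swap_apply v_diff_step v_diff_swap[of "i + 1" i])
  qed
  have succ: "gen_act i (v_diff (a + 1) b) = gen_act i (v_diff a b) - gen_act i (alpha a)" for a
    by (simp add: v_diff_succ gen_act.hom_minus)
  have split: "v_diff (simple_swap i a) c = gen_act i (alpha a) + v_diff (simple_swap i (a + 1)) c" for a c
    by (simp add: step v_diff_trans)
  show ?thesis
  proof (induction a rule: int_induct[where k = b])
    case base
    then show ?case by (simp del: transpose_apply_other)
  next
    case (step1 a)
    then show ?case using succ[of a] split[of a "simple_swap i b"] by (simp del: transpose_apply_other)
  next
    case (step2 a)
    then show ?case using succ[of "a - 1"] split[of "a - 1" "simple_swap i b"] 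
      by (simp del: transpose_apply_other)
  qed
qed

text \<open>For \<open>a < b\<close> the difference arises from \<open>alpha a\<close> by successive
  generators, and field homomorphisms keep nonzero elements nonzero.\<close>

lemma v_diff_nonzero:
  assumes "a \<noteq> b"
  shows "v_diff a b \<noteq> 0"
proof -
  have less: "v_diff a b \<noteq> 0" if "a < b" for a b
    using that
  proof (induction b rule: int_gr_induct)
    case base
    then show ?case by (simp add: v_diff_step)
  next
    case (step b)
    have "gen_act b (v_diff a b) \<noteq> 0" using step by simp
    then show ?case using step by (simp add: gen_act_v_diff simple_swap_apply)
  qed
  show ?thesis using less[of a b] less[of b a] v_diff_swap[of a b] assms by (cases "a < b") auto
qed

section \<open>Partitions and Maya diagrams\<close>

text \<open>For the partition of \<open>w\<close> these are the elements of the Maya diagram in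
  decreasing order; \<open>col_pos\<close> lists the complement, the gaps, in increasing
  order.\<close>

definition row_pos :: "nat list \<Rightarrow> nat \<Rightarrow> int" where
  "row_pos lam i = int (part lam i) - int i + 1"

definition col_pos :: "nat list \<Rightarrow> nat \<Rightarrow> int" where
  "col_pos lam j = int j - int (conj_part lam j)"

lemma part_antimono:
  assumes "is_partition lam" "1 \<le> i" "i \<le> j"
  shows "part lam j \<le> part lam i"
proof (cases "j \<le> length lam \<and> i < j")
  case True
  then have "lam ! (j - 1) \<le> lam ! (i - 1)"
    using assms by (auto simp: is_partition_def sorted_wrt_iff_nth_less)
  then show ?thesis using True assms by (simp add: part_def)
next
  case False
  then show ?thesis using assms by (cases "i = j") (auto simp: part_def)
qed

lemma part_pos_iff: "is_partition lam \<Longrightarrow> 0 < part lam i \<longleftrightarrow> 1 \<le> i \<and> i \<le> length lam"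
  by (auto simp: part_def is_partition_def)

text \<open>As the parts decrease, the rows reaching column \<open>j\<close> form an initial
  segment, and \<open>conj_part\<close> is its length.\<close>

lemma le_conj_part_iff:
  assumes "is_partition lam" "1 \<le> i" "1 \<le> j"
  shows "i \<le> conj_part lam j \<longleftrightarrow> j \<le> part lam i"
proof
  let ?S = "{i \<in> {1..length lam}. j \<le> part lam i}"
  assume "j \<le> part lam i"
  then have "j \<le> part lam i'" if "1 \<le> i'" "i' \<le> i" for i'
    using part_antimono[OF assms(1) that] by simp
  then have "{1..i} \<subseteq> ?S" using part_pos_iff[OF assms(1)] assms(3) by fastforce
  then have "card {1..i} \<le> card ?S" by (intro card_mono) auto
  then show "i \<le> conj_part lam j" by (simp add: conj_part_def)
next
  let ?S = "{i \<in> {1..length lam}. j \<le> part lam i}"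
  assume le: "i \<le> conj_part lam j"
  show "j \<le> part lam i"
  proof (rule ccontr)
    assume "\<not> j \<le> part lam i"
    then have "i' < i" if "1 \<le> i'" "j \<le> part lam i'" for i'
      using part_antimono[OF assms(1,2), of i'] that by (cases "i \<le> i'") auto
    then have "?S \<subseteq> {1..<i}" by auto
    then have "card ?S \<le> card {1..<i}" by (intro card_mono) auto
    then show False using le assms(2) by (simp add: conj_part_def)
  qed
qed

lemma conj_part_le_length: "conj_part lam j \<le> length lam"
proof -
  have "card {i \<in> {1..length lam}. j \<le> part lam i} \<le> card {1..length lam}" by (intro card_mono) auto
  then show ?thesis by (simp add: conj_part_def)
qed

lemma conj_part_antimono: "i \<le> j \<Longrightarrow> conj_part lam j \<le> conj_part lam i"
  unfolding conj_part_def by (intro card_mono) auto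

lemma row_pos_less: "is_partition lam \<Longrightarrow> 1 \<le> i \<Longrightarrow> i < j \<Longrightarrow> row_pos lam j < row_pos lam i"
  using part_antimono[of lam i j] by (simp add: row_pos_def)

lemma col_pos_less: "i < j \<Longrightarrow> col_pos lam i < col_pos lam j"
  using conj_part_antimono[of i j lam] by (simp add: col_pos_def)

lemma inj_on_row_pos: "is_partition lam \<Longrightarrow> inj_on (row_pos lam) {1..}"
  by (rule linorder_inj_onI) (auto dest: row_pos_less)

lemma inj_on_col_pos: "inj_on (col_pos lam) A"
  by (rule linorder_inj_onI) (auto dest: col_pos_less[of _ _ lam])

text \<open>By duality \<open>j \<le> part lam i\<close> and \<open>i \<le> conj_part lam j\<close>
  hold together or fail together; adding them, or their negations, decides the comparison and rules
  out equality.\<close>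

lemma col_row_pos:
  assumes "is_partition lam" "1 \<le> i" "1 \<le> j"
  shows "col_pos lam j < row_pos lam i \<longleftrightarrow> j \<le> part lam i" "col_pos lam j \<noteq> row_pos lam i"
proof -
  have "j \<le> part lam i \<and> i \<le> conj_part lam j \<or> part lam i < j \<and> conj_part lam j < i"
    using le_conj_part_iff[OF assms] by linarith
  then show "col_pos lam j < row_pos lam i \<longleftrightarrow> j \<le> part lam i" "col_pos lam j \<noteq> row_pos lam i"
    unfolding col_pos_def row_pos_def by linarith+
qed

text \<open>A count: both sequences are injective and avoid each other, so they give
  \<open>2 * n\<close> integers in an interval of that size.\<close>

lemma row_col_pos_Un:
  assumes "is_partition lam" "length lam \<le> n" "part lam 1 \<le> n"
  shows "row_pos lam ` {1..n} \<union> col_pos lam ` {1..n} = {1 - int n..int n}"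
proof (rule card_subset_eq)
  have "row_pos lam i \<in> {1 - int n..int n}" if "1 \<le> i" "i \<le> n" for i
    using that part_antimono[OF assms(1) _ that(1)] assms(3) by (simp add: row_pos_def)
  moreover have "col_pos lam j \<in> {1 - int n..int n}" if "1 \<le> j" "j \<le> n" for j
    using that conj_part_le_length[of lam j] assms(2) by (simp add: col_pos_def)
  ultimately show "row_pos lam ` {1..n} \<union> col_pos lam ` {1..n} \<subseteq> {1 - int n..int n}"
    by auto
  have "card (row_pos lam ` {1..n} \<union> col_pos lam ` {1..n}) =
      card (row_pos lam ` {1..n}) + card (col_pos lam ` {1..n})"
  proof (rule card_Un_disjoint)
    have "row_pos lam i \<noteq> col_pos lam j" if "1 \<le> i" "1 \<le> j" for i j
      using col_row_pos(2)[OF assms(1) that] by simp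
    then show "row_pos lam ` {1..n} \<inter> col_pos lam ` {1..n} = {}" by auto
  qed simp_all
  also have "\<dots> = n + n"
    using inj_on_subset[OF inj_on_row_pos[OF assms(1)], of "{1..n}"] inj_on_col_pos[of lam "{1..n}"]
    by (simp add: card_image)
  finally show "card (row_pos lam ` {1..n} \<union> col_pos lam ` {1..n}) = card {1 - int n..int n}"
    by simp
qed simp

lemma col_pos_image:
  assumes "is_partition lam" "length lam \<le> n" "part lam 1 \<le> n"
  shows "col_pos lam ` {1..n} = {1 - int n..int n} - row_pos lam ` {1..n}"
proof -
  have "col_pos lam j \<noteq> row_pos lam i" if "1 \<le> i" "1 \<le> j" for i j
    using col_row_pos(2)[OF assms(1) that] .
  then have "row_pos lam ` {1..n} \<inter> col_pos lam ` {1..n} = {}" by fastforce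
  then show ?thesis using row_col_pos_Un[OF assms] by blast
qed

lemma range_col_pos:
  assumes "is_partition lam"
  shows "col_pos lam ` {1..} = - row_pos lam ` {1..}"
proof -
  have "x \<in> row_pos lam ` {1..} \<union> col_pos lam ` {1..}" for x
  proof -
    define n where "n = length lam + part lam 1 + nat \<bar>x\<bar> + 1"
    have "x \<in> {1 - int n..int n}" by (auto simp: n_def)
    then have "x \<in> row_pos lam ` {1..n} \<union> col_pos lam ` {1..n}"
      by (subst row_col_pos_Un) (use assms in \<open>auto simp: n_def\<close>)
    then show ?thesis by auto
  qed
  moreover have "col_pos lam j \<noteq> row_pos lam i" if "1 \<le> i" "1 \<le> j" for i j
    using col_row_pos(2)[OF assms that] .
  ultimately show ?thesis by fastforce
qed

section \<open>The Frobenius symbol and the Maya diagram\<close>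

lemma le_frobenius_rank_iff:
  assumes "is_partition lam" "1 \<le> n"
  shows "n \<le> frobenius_rank lam \<longleftrightarrow> n \<le> part lam n"
proof
  let ?S = "{n \<in> {1..length lam}. n \<le> part lam n}"
  assume le: "n \<le> frobenius_rank lam"
  have "frobenius_rank lam \<in> insert 0 ?S"
    unfolding frobenius_rank_def by (rule Max_in) auto
  then show "n \<le> part lam n"
    using le assms part_antimono[OF assms(1,2) le] by auto
next
  assume "n \<le> part lam n"
  then show "n \<le> frobenius_rank lam"
    unfolding frobenius_rank_def using assms part_pos_iff[OF assms(1), of n] by (intro Max_ge) auto
qed

lemma frobenius_I_eq:
  assumes "is_partition lam"
  shows "frobenius_I lam = row_pos lam ` {1..} \<inter> {0<..}"
proof -
  have "n \<le> frobenius_rank lam \<longleftrightarrow> 0 < row_pos lam n" if "1 \<le> n" for n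
    using le_frobenius_rank_iff[OF assms that] by (auto simp: row_pos_def)
  then have "{1..frobenius_rank lam} = {n \<in> {1..}. 0 < row_pos lam n}" by auto
  then show ?thesis
    unfolding frobenius_I_def by (auto simp: row_pos_def)
qed

lemma frobenius_J_eq:
  assumes "is_partition lam"
  shows "uminus ` frobenius_J lam = col_pos lam ` {1..} \<inter> {..0}"
proof -
  have "n \<le> frobenius_rank lam \<longleftrightarrow> col_pos lam n \<le> 0" if "1 \<le> n" for n
    using le_frobenius_rank_iff[OF assms that] le_conj_part_iff[OF assms that that]
    by (simp add: col_pos_def)
  then have "{1..frobenius_rank lam} = {n \<in> {1..}. col_pos lam n \<le> 0}" by auto
  then show ?thesis
    unfolding frobenius_J_def image_image by (auto simp: col_pos_def)
qed

text \<open>The symbol records \<open>M\<close> above zero and the complement of \<open>M\<close> at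
  or below zero, hence all of \<open>M\<close>. This reduces \<open>partition_of\<close> to one
  equation between sets.\<close>

lemma frobenius_maya_iff:
  assumes "is_partition lam"
  shows "frobenius_I lam = M \<inter> {0<..} \<and> uminus ` frobenius_J lam = {..0} - M \<longleftrightarrow>
    row_pos lam ` {1..} = M"
proof -
  have "R \<inter> {0<..} = M \<inter> {0<..} \<and> - R \<inter> {..0} = {..0} - M \<longleftrightarrow> R = M" (is "?L \<longleftrightarrow> _")
    for R :: "int set"
  proof
    assume eq: ?L
    have "R = (R \<inter> {0<..}) \<union> ({..0} - (- R \<inter> {..0}))" by auto
    also have "\<dots> = (M \<inter> {0<..}) \<union> ({..0} - ({..0} - M))" using eq by simp
    also have "\<dots> = M" by auto
    finally show "R = M" .
  next
    assume eq: "R = M"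
    show ?L unfolding eq by (simp add: Diff_eq Int_commute)
  qed
  then show ?thesis
    unfolding frobenius_I_eq[OF assms] frobenius_J_eq[OF assms] range_col_pos[OF assms] .
qed

text \<open>A set of integers has at most one strictly decreasing enumeration.\<close>

lemma row_pos_image_inject:
  assumes lam: "is_partition lam" and mu: "is_partition mu"
    and eq: "row_pos lam ` {1..} = row_pos mu ` {1..}"
  shows "lam = mu"
proof -
  \<comment> \<open>If the first sequence were larger at \<open>i\<close>, its value would occur
    earlier in the second one, where both agree, against strict descent. Stated for any two
    partitions so that it applies in both directions.\<close>
  have le: "row_pos lam i \<le> row_pos mu i"
    if "is_partition lam" "is_partition mu" "row_pos lam ` {1..} = row_pos mu ` {1..}" "1 \<le> i"
      "\<And>j. 1 \<le> j \<Longrightarrow> j < i \<Longrightarrow> row_pos lam j = row_pos mu j" for lam mu i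
  proof (rule ccontr)
    assume less: "\<not> row_pos lam i \<le> row_pos mu i"
    have "row_pos lam i \<in> row_pos mu ` {1..}" using that(3,4) by auto
    then obtain k where k: "1 \<le> k" "row_pos lam i = row_pos mu k" by auto
    then have "k < i"
      using less row_pos_less[OF that(2,4), of k] by (cases k i rule: linorder_cases) auto
    then show False using k that(5) row_pos_less[OF that(1) k(1)] by fastforce
  qed
  have "row_pos lam i = row_pos mu i" if "1 \<le> i" for i
    using that
  proof (induction i rule: less_induct)
    case (less i)
    show ?case
      by (rule antisym; rule le) (use lam mu eq less in auto)
  qed
  then have parts: "part lam i = part mu i" for i
    by (cases "1 \<le> i") (auto simp: row_pos_def part_def)
  have "i \<le> length lam \<longleftrightarrow> i \<le> length mu" for i
    using part_pos_iff[OF lam, of i] part_pos_iff[OF mu, of i] parts[of i] by (cases i) auto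
  then have "length lam = length mu" by (metis le_antisym le_refl)
  moreover have "lam ! i = mu ! i" if "i < length lam" for i
    using that parts[of "Suc i"] \<open>length lam = length mu\<close> by (simp add: part_def)
  ultimately show ?thesis by (intro nth_equalityI) auto
qed

text \<open>With \<open>S\<close> listed downwards as \<open>xs\<close>, the parts must be
  \<open>xs ! k + k\<close>, counted from zero. Strict descent makes them weakly decreasing, and the
  bounds on \<open>S\<close> keep them between 0 and \<open>n\<close>.\<close>

lemma ex_partition:
  assumes S: "S \<subseteq> {1 - int n..int n}" "card S = n"
  obtains lam where "is_partition lam" "length lam \<le> n" "part lam 1 \<le> n" "row_pos lam ` {1..n} = S"
proof -
  define xs where "xs = rev (sorted_list_of_set S)"
  have fin: "finite S" using S(1) finite_subset by blast
  have len: "length xs = n" and set: "set xs = S"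
    using fin S(2) by (simp_all add: xs_def)
  have desc: "xs ! j < xs ! i" if "i < j" "j < n" for i j
    using that fin strict_sorted_list_of_set[of S] S(2)
    by (auto simp: xs_def rev_nth sorted_wrt_iff_nth_less)
  have gap: "xs ! j + int j \<le> xs ! i + int i" if "i \<le> j" "j < n" for i j
    using that
  proof (induction j rule: dec_induct)
    case (step j)
    then show ?case using desc[of j "Suc j"] by simp
  qed simp
  have bounds: "0 \<le> xs ! i + int i" "xs ! i + int i \<le> int n" if "i < n" for i
  proof -
    have "xs ! (n - 1) \<in> S" "xs ! 0 \<in> S"
      using that len nth_mem[of _ xs] unfolding set by simp_all
    then have "1 - int n \<le> xs ! (n - 1)" "xs ! 0 \<le> int n" using S(1) by auto
    moreover have "i \<le> n - 1" using that by simp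
    ultimately show "0 \<le> xs ! i + int i" "xs ! i + int i \<le> int n"
      using gap[of i "n - 1"] gap[of 0 i] that by auto
  qed
  \<comment> \<open>The value 0 from \<open>n\<close> on guarantees a first zero \<open>l\<close>;
    cutting there leaves only positive parts.\<close>
  define g where "g k = (if k < n then nat (xs ! k + int k) else 0)" for k
  have g_anti: "g j \<le> g i" if "i \<le> j" for i j
    using that gap[of i j] by (auto simp: g_def intro: nat_mono)
  define l where "l = (LEAST k. g k = 0)"
  have gl: "g l = 0" unfolding l_def by (rule LeastI[of _ n]) (simp add: g_def)
  have l_pos: "0 < g k" if "k < l" for k using not_less_Least[of k "\<lambda>k. g k = 0"] that l_def by auto
  have l_le: "l \<le> n" unfolding l_def by (rule Least_le) (simp add: g_def)
  define lam where "lam = map g [0..<l]"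
  have part: "part lam (Suc k) = g k" for k
    using g_anti[of l k] gl by (simp add: part_def lam_def)
  show ?thesis
  proof (rule that)
    show "is_partition lam"
      by (auto simp: is_partition_def lam_def sorted_wrt_iff_nth_less l_pos intro: g_anti)
    show "length lam \<le> n" using l_le by (simp add: lam_def)
    show "part lam 1 \<le> n" using part[of 0] bounds(2)[of 0] by (simp add: g_def nat_le_iff)
    have "row_pos lam (Suc k) = xs ! k" if "k < n" for k
      using bounds(1)[OF that] that by (simp add: row_pos_def part g_def)
    then have "(\<lambda>k. row_pos lam (Suc k)) ` {..<n} = (!) xs ` {..<n}" by (intro image_cong) auto
    also have "\<dots> = S" using len set by (auto simp: in_set_conv_nth)
    finally show "row_pos lam ` {1..n} = S"
      unfolding image_Suc_lessThan[symmetric] image_image .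
  qed
qed

lemma row_pos_image_atLeast:
  assumes "length lam \<le> n"
  shows "row_pos lam ` {1..} = {..- int n} \<union> row_pos lam ` {1..n}"
proof -
  have "row_pos lam ` {Suc n..} = {..- int n}"
  proof (intro equalityI subsetI)
    fix x assume "x \<in> {..- int n}"
    then show "x \<in> row_pos lam ` {Suc n..}"
      using assms by (intro image_eqI[of _ _ "nat (1 - x)"]) (auto simp: row_pos_def part_def)
  qed (use assms in \<open>auto simp: row_pos_def part_def\<close>)
  moreover have "{1..} = {Suc n..} \<union> {1..n}" by auto
  ultimately show ?thesis by (metis image_Un)
qed

lemma partition_of_eqI:
  assumes "is_partition lam" "row_pos lam ` {1..} = maya w"
  shows "partition_of w = lam"
  unfolding partition_of_def
proof (rule the_equality)
  show "is_partition lam \<and> frobenius_I lam = maya w \<inter> {0<..} \<and>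
      uminus ` frobenius_J lam = {..0} - maya w"
    using frobenius_maya_iff[OF assms(1), of "maya w"] assms by simp
next
  fix mu
  assume "is_partition mu \<and> frobenius_I mu = maya w \<inter> {0<..} \<and>
      uminus ` frobenius_J mu = {..0} - maya w"
  then have "is_partition mu" "row_pos mu ` {1..} = maya w"
    using frobenius_maya_iff[of mu "maya w"] by simp_all
  then show "mu = lam" using row_pos_image_inject assms by simp
qed

lemma partition_of_maya:
  assumes M: "maya w = {..- int n} \<union> S" and S: "S \<subseteq> {1 - int n..int n}" "card S = n"
  shows "is_partition (partition_of w)" "length (partition_of w) \<le> n"
    "part (partition_of w) 1 \<le> n" "row_pos (partition_of w) ` {1..n} = S"
proof -
  obtain lam where lam: "is_partition lam" "length lam \<le> n" "part lam 1 \<le> n" "row_pos lam ` {1..n} = S"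
    using ex_partition[OF S] by metis
  have "partition_of w = lam"
    using row_pos_image_atLeast[OF lam(2)] lam(1,4) M by (intro partition_of_eqI) simp_all
  then show "is_partition (partition_of w)" "length (partition_of w) \<le> n"
    "part (partition_of w) 1 \<le> n" "row_pos (partition_of w) ` {1..n} = S"
    using lam by simp_all
qed

text \<open>By \<open>col_row_pos\<close> the cells correspond to pairs of an element
  \<open>m\<close> of \<open>S\<close> and a smaller gap \<open>c\<close>. In this form the factor
  can be compared with products over the window from \<open>1 - n\<close> to
  \<open>n\<close>.\<close>

lemma norm_factor_eq:
  assumes "is_partition lam" "length lam \<le> n" "part lam 1 \<le> n"
  defines "S \<equiv> row_pos lam ` {1..n}"
  shows "norm_factor lam =
    (\<Prod>(m, c)\<in>{(m, c) \<in> S \<times> ({1 - int n..int n} - S). c < m}. v_diff c m)"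
proof -
  have C: "{1 - int n..int n} - S = col_pos lam ` {1..n}"
    unfolding S_def col_pos_image[OF assms(1-3)] ..
  have le: "part lam i \<le> n" if "1 \<le> i" for i
    using part_antimono[OF assms(1) _ that] assms(3) by simp
  let ?g = "\<lambda>(i, j). (row_pos lam i, col_pos lam j)"
  have diag: "diagram lam \<subseteq> {1..n} \<times> {1..n}"
    using assms(2) le by (force simp: diagram_def)
  have "bij_betw ?g (diagram lam) {(m, c) \<in> S \<times> ({1 - int n..int n} - S). c < m}"
  proof (rule bij_betw_imageI)
    show "inj_on ?g (diagram lam)"
      using inj_on_row_pos[OF assms(1)] inj_on_col_pos[of lam UNIV]
      by (auto simp: inj_on_def diagram_def)
    show "?g ` diagram lam = {(m, c) \<in> S \<times> ({1 - int n..int n} - S). c < m}"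
    proof (intro equalityI subsetI)
      fix p assume "p \<in> ?g ` diagram lam"
      then show "p \<in> {(m, c) \<in> S \<times> ({1 - int n..int n} - S). c < m}"
        using diag col_row_pos(1)[OF assms(1)] unfolding C unfolding S_def
        by (auto simp: diagram_def)
    next
      fix p assume "p \<in> {(m, c) \<in> S \<times> ({1 - int n..int n} - S). c < m}"
      then obtain i j where ij: "i \<in> {1..n}" "j \<in> {1..n}" "p = (row_pos lam i, col_pos lam j)"
        "col_pos lam j < row_pos lam i" unfolding C unfolding S_def by auto
      then have "j \<le> part lam i" "1 \<le> j" using col_row_pos(1)[OF assms(1), of i j] by auto
      then have "(i, j) \<in> diagram lam"
        using part_pos_iff[OF assms(1), of i] by (auto simp: diagram_def)
      then show "p \<in> ?g ` diagram lam" using ij(3) by (auto intro: rev_image_eqI)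
    qed
  qed
  from prod.reindex_bij_betw[OF this, of "\<lambda>(m, c). v_diff c m"] show ?thesis
    by (simp add: norm_factor_def row_pos_def col_pos_def case_prod_unfold)
qed

section \<open>Words in the generators\<close>

lemma weyl_perm_abs: "weyl_perm (abs_weyl xs) = foldr simple_swap xs"
proof
  fix j
  have "foldr gen_weight xs (vwt j) = vwt (foldr simple_swap xs j)"
    by (induction xs) (simp_all add: gen_weight_vwt simple_swap_apply)
  then show "weyl_perm (abs_weyl xs) j = foldr simple_swap xs j"
    using weyl_perm[of "abs_weyl xs" j] by (simp add: weyl_weight.abs_eq vwt_inject)
qed

lemma bij_foldr_swap: "bij (foldr simple_swap xs)"
proof (induction xs)
  case (Cons i xs)
  then show ?case unfolding foldr.simps by (intro bij_comp) simp_all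
qed (simp add: bij_id[unfolded id_def])

text \<open>Letters strictly between \<open>- n\<close> and \<open>n\<close> move only positions in
  the window from \<open>1 - n\<close> to \<open>n\<close>, which makes finite determinants and
  products possible.\<close>

lemma foldr_swap_fixed:
  assumes "\<forall>i\<in>set xs. - int n < i \<and> i < int n" "a \<notin> {1 - int n..int n}"
  shows "foldr simple_swap xs a = a"
  using assms(1)
proof (induction xs)
  case (Cons i xs)
  then have "- int n < i" "i < int n" by simp_all
  then have "simple_swap i a = a" using assms(2) by (auto simp: simple_swap_apply)
  then show ?case using Cons by simp
qed simp

lemma simple_swap_in_range:
  "- int n < i \<Longrightarrow> i < int n \<Longrightarrow> simple_swap i a \<in> {1 - int n..int n} \<longleftrightarrow> a \<in> {1 - int n..int n}"
  by (auto simp: simple_swap_apply)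

lemma foldr_swap_in_range:
  assumes "\<forall>i\<in>set xs. - int n < i \<and> i < int n"
  shows "foldr simple_swap xs a \<in> {1 - int n..int n} \<longleftrightarrow> a \<in> {1 - int n..int n}"
  using assms
proof (induction xs)
  case (Cons i xs)
  then have "- int n < i" "i < int n" by simp_all
  then show ?case
    using Cons by (simp only: foldr.simps comp_apply simple_swap_in_range) simp
qed simp

lemma field_hom_foldr: "field_hom (foldr gen_act xs)"
proof (induction xs)
  case Nil
  show ?case by unfold_locales auto
next
  case (Cons i xs)
  then show ?case unfolding foldr.simps by (intro field_hom_comp field_hom_gen)
qed

lemma foldr_gen_act_v_diff:
  "foldr gen_act xs (v_diff a b) = v_diff (foldr simple_swap xs a) (foldr simple_swap xs b)"
  by (induction xs) (simp_all add: gen_act_v_diff)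

section \<open>Tau monomials and the denominator of \<open>phi\<close>\<close>

definition tau_monom :: "(int \<Rightarrow>\<^sub>0 int) \<Rightarrow> ratfun" where
  "tau_monom \<mu> = (\<Prod>i\<in>Poly_Mapping.keys \<mu>. tau i powi Poly_Mapping.lookup \<mu> i)"

lemma tau_monom_superset:
  assumes "finite A" "Poly_Mapping.keys \<mu> \<subseteq> A"
  shows "tau_monom \<mu> = (\<Prod>i\<in>A. tau i powi Poly_Mapping.lookup \<mu> i)"
  unfolding tau_monom_def using assms
  by (intro prod.mono_neutral_left) (auto simp: in_keys_iff)

lemma tau_monom_add: "tau_monom (x + y) = tau_monom x * tau_monom y"
proof -
  let ?A = "Poly_Mapping.keys x \<union> Poly_Mapping.keys y"
  have "Poly_Mapping.keys (x + y) \<subseteq> ?A" by (rule Poly_Mapping.keys_add)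
  then show ?thesis
    by (simp add: tau_monom_superset[of ?A] lookup_add power_int_add prod.distrib)
qed

lemma tau_monom_0: "tau_monom 0 = 1"
  by (simp add: tau_monom_def)

lemma tau_monom_frag_of: "tau_monom (frag_of j) = tau j"
  by (simp add: tau_monom_def)

lemma tau_monom_vwt: "tau_monom (vwt j) = tau j / tau (j - 1)"
  using tau_monom_add[of "vwt j" "frag_of (j - 1)"]
  by (simp add: vwt_def tau_monom_frag_of field_simps)

lemma tau_monom_sum: "tau_monom (sum g A) = (\<Prod>x\<in>A. tau_monom (g x))"
  by (induction A rule: infinite_finite_induct) (simp_all add: tau_monom_add tau_monom_0)

lemma gen_weight_sum: "gen_weight i (sum g A) = (\<Sum>x\<in>A. gen_weight i (g x))"
proof -
  have "gen_weight i 0 = 0" using gen_weight_simps(3)[of i 0 0] by simp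
  then show ?thesis
    by (induction A rule: infinite_finite_induct) (simp_all add: gen_weight_simps(2))
qed

text \<open>The finite form of the formal expansion of \<open>\<Lambda>\<^sub>0\<close> into all
  \<open>v\<^sub>j\<close> with \<open>j \<le> 0\<close>; the tail is collected in
  \<open>frag_of (- int n)\<close>, which every generator other than \<open>- n\<close>
  fixes.\<close>

lemma frag_of_zero_eq: "frag_of 0 = frag_of (- int n) + (\<Sum>a<n. vwt (- int a))"
proof (induction n)
  case (Suc n)
  have "- int (Suc n) = - int n - 1" by simp
  then show ?case using Suc by (simp only: vwt_def sum.lessThan_Suc) (simp add: algebra_simps)
qed simp

lemma gen_weight_vwt_swap: "gen_weight i (vwt j) = vwt (simple_swap i j)"
  by (simp add: gen_weight_vwt simple_swap_apply)

lemma weyl_weight_frag_of_zero: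
  assumes "\<forall>i\<in>set xs. - int n < i \<and> i < int n"
  shows "weyl_weight (abs_weyl xs) (frag_of 0) =
    frag_of (- int n) + (\<Sum>a<n. vwt (foldr simple_swap xs (- int a)))"
  unfolding weyl_weight.abs_eq frag_of_zero_eq[of n] using assms
proof (induction xs)
  case (Cons i xs)
  then have IH: "foldr gen_weight xs (frag_of (- int n) + (\<Sum>a<n. vwt (- int a))) =
    frag_of (- int n) + (\<Sum>a<n. vwt (foldr simple_swap xs (- int a)))" and "i \<noteq> - int n"
    by fastforce+
  then show ?case
    by (simp add: IH gen_weight_simps(1,2) gen_weight_sum gen_weight_vwt_swap)
qed simp

lemma phi_eq_divide:
  assumes "\<forall>i\<in>set xs. - int n < i \<and> i < int n"
  defines "y \<equiv> \<lambda>a. foldr simple_swap xs (- int a)"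
  shows "phi (abs_weyl xs) =
    foldr gen_act xs (tau 0) / (tau (- int n) * (\<Prod>a<n. tau (y a) / tau (y a - 1)))"
proof -
  have "phi (abs_weyl xs) = foldr gen_act xs (tau 0) / tau_monom (weyl_weight (abs_weyl xs) (frag_of 0))"
    by (simp add: phi_def tau_monom_def weyl_act.abs_eq Let_def)
  also have "weyl_weight (abs_weyl xs) (frag_of 0) = frag_of (- int n) + (\<Sum>a<n. vwt (y a))"
    unfolding y_def by (rule weyl_weight_frag_of_zero) (rule assms(1))
  finally show ?thesis
    by (simp add: tau_monom_add tau_monom_sum tau_monom_frag_of tau_monom_vwt)
qed

section \<open>The determinant of a word\<close>

definition v_prod :: "nat \<Rightarrow> int \<Rightarrow> ratfun" where
  "v_prod n a = (\<Prod>q\<in>{a<..int n}. v_diff q a)"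

lemma v_prod_nonzero: "v_prod n a \<noteq> 0"
  by (auto simp: v_prod_def v_diff_nonzero)

text \<open>As \<open>i < n\<close>, the indices \<open>i\<close> and \<open>i + 1\<close> lie both
  inside the range of the product or both outside, so the swap only permutes the factors.\<close>

lemma gen_act_v_prod_fixed:
  assumes i: "i < int n" and a: "a \<noteq> i" "a \<noteq> i + 1"
  shows "gen_act i (v_prod n a) = v_prod n a"
proof -
  have "gen_act i (v_prod n a) = (\<Prod>q\<in>{a<..int n}. v_diff (simple_swap i q) a)"
    using a by (simp add: v_prod_def gen_act.hom_prod gen_act_v_diff)
  also have "\<dots> = v_prod n a"
    unfolding v_prod_def using a i
    by (intro prod.reindex_bij_witness[of _ "simple_swap i" "simple_swap i"])
      (auto simp: simple_swap_apply)
  finally show ?thesis .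
qed

text \<open>The factor for \<open>q = i + 1\<close> becomes \<open>alpha i\<close>, which is there
  to cancel the scalar in \<open>gen_act_tau_mat\<close>.\<close>

lemma gen_act_v_prod_left:
  assumes "i < int n"
  shows "gen_act i (v_prod n i) = alpha i * v_prod n (i + 1)"
proof -
  have "{i<..int n} = insert (i + 1) {i + 1<..int n}" using assms by auto
  moreover have "(\<Prod>q\<in>{i + 1<..int n}. v_diff (simple_swap i q) (i + 1)) = v_prod n (i + 1)"
    unfolding v_prod_def by (intro prod.cong) (auto simp: simple_swap_apply)
  ultimately show ?thesis
    by (simp add: v_prod_def gen_act.hom_mult gen_act.hom_prod gen_act_v_diff v_diff_step)
qed

lemma gen_act_v_prod_right:
  assumes "i < int n"
  shows "gen_act i (v_prod n (i + 1)) = - v_prod n i / alpha i"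
proof -
  have "v_prod n i = - alpha i * gen_act i (v_prod n (i + 1))"
    using arg_cong[OF gen_act_v_prod_left[OF assms], of "gen_act i"]
    by (simp add: gen_act_involution gen_act.hom_mult gen_act_var)
  then show ?thesis by simp
qed

text \<open>The minor is written transposed: \<open>a\<close> indexes the chosen columns
  \<open>y a\<close> and \<open>b\<close> the row \<open>- b\<close>. Row operations on
  \<open>tau_mat\<close> therefore appear as column operations.\<close>

definition tau_det :: "nat \<Rightarrow> (nat \<Rightarrow> int) \<Rightarrow> ratfun" where
  "tau_det n y = det (mat n n (\<lambda>(a, b). tau_mat (- int b) (y a) / v_prod n (y a)))"

text \<open>Dividing the columns of \<open>tau_mat\<close> by \<open>v_prod\<close> turns the column operation of
  \<open>gen_act_tau_mat\<close> into a plain transposition of columns.\<close>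

lemma gen_act_tau_mat_quot:
  assumes "i < int n"
  shows "gen_act i (tau_mat b a / v_prod n a) =
    tau_mat b (simple_swap i a) / v_prod n (simple_swap i a) -
    (if b = i + 1
     then alpha i / fvar i * (tau_mat i (simple_swap i a) / v_prod n (simple_swap i a)) else 0)"
proof -
  consider "a = i" | "a = i + 1" | "a \<noteq> i" "a \<noteq> i + 1" by blast
  then show ?thesis
    by cases (simp_all add: gen_act.hom_div gen_act_tau_mat gen_act_v_prod_fixed[OF assms]
        gen_act_v_prod_left[OF assms] gen_act_v_prod_right[OF assms] v_prod_nonzero
        simple_swap_apply diff_divide_distrib, simp add: v_prod_nonzero field_simps)
qed

text \<open>For \<open>i < 0\<close> the rows \<open>i\<close> and \<open>i + 1\<close> both belong
  to the minor, by \<open>- n < i\<close>, and adding a multiple of one to the other preserves it.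
  For \<open>i \<ge> 0\<close> the altered row \<open>i + 1\<close> lies outside.\<close>

lemma gen_act_tau_det:
  assumes i: "- int n < i" "i < int n"
  shows "gen_act i (tau_det n y) = tau_det n (\<lambda>a. simple_swap i (y a))"
proof -
  define X where "X y = mat n n (\<lambda>(a, b). tau_mat (- int b) (y a) / v_prod n (y a))" for y
  have X: "X y \<in> carrier_mat n n" for y by (simp add: X_def)
  have hom: "gen_act i (tau_det n y) = det (map_mat (gen_act i) (X y))"
    by (simp add: tau_det_def X_def)
  show ?thesis
  proof (cases "i < 0")
    case True
    \<comment> \<open>The indices in the minor of the rows \<open>i + 1\<close> and
      \<open>i\<close>.\<close>
    define k l where "k = nat (- i - 1)" and "l = nat (- i)"
    have kl: "k < n" "l < n" "k \<noteq> l" "- int l = i" "\<And>b. - int b = i + 1 \<longleftrightarrow> k = b"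
      using True i by (auto simp: k_def l_def)
    have "map_mat (gen_act i) (X y) = addcol (- (alpha i / fvar i)) k l (X (\<lambda>a. simple_swap i (y a)))"
      using kl by (intro eq_matI) (auto simp: X_def mat_addcol_def gen_act_tau_mat_quot[OF i(2)])
    then show ?thesis
      unfolding hom using det_addcol[OF kl(2,3) X] by (simp add: tau_det_def X_def)
  next
    case False
    then have "map_mat (gen_act i) (X y) = X (\<lambda>a. simple_swap i (y a))"
      by (intro eq_matI) (auto simp: X_def gen_act_tau_mat_quot[OF i(2)])
    then show ?thesis unfolding hom by (simp add: tau_det_def X_def)
  qed
qed

text \<open>The case of the empty word: the matrix is triangular and the quotients of the
  \<open>tau\<close> telescope.\<close>

lemma tau_det_triangular:
  "tau 0 / (\<Prod>a<n. v_prod n (- int a)) = tau (- int n) * tau_det n (\<lambda>a. - int a)"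
proof -
  let ?X = "mat n n (\<lambda>(a, b). tau_mat (- int b) (- int a) / v_prod n (- int a))"
  have "upper_triangular ?X" by (auto simp: tau_mat_def row_mat_below)
  then have "tau_det n (\<lambda>a. - int a) = prod_list (diag_mat ?X)"
    unfolding tau_det_def by (rule det_upper_triangular[of _ n]) simp
  also have "\<dots> = (\<Prod>a<n. tau (- int a) / tau (- int a - 1) / v_prod n (- int a))"
    unfolding prod_list_diag_prod by (simp add: tau_mat_def row_mat_diag atLeast0LessThan)
  also have "\<dots> = (\<Prod>a<n. tau (- int a) / tau (- int a - 1)) / (\<Prod>a<n. v_prod n (- int a))"
    by (simp add: prod_dividef prod.distrib)
  also have "(\<Prod>a<n. tau (- int a) / tau (- int a - 1)) = tau 0 / tau (- int n)"
  proof (induction n)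
    case (Suc n)
    have "- int (Suc n) = - int n - 1" by simp
    then show ?case using Suc by (simp only: prod.lessThan_Suc) simp
  qed simp
  finally show ?thesis by simp
qed

lemma foldr_gen_act_tau:
  assumes "\<forall>i\<in>set xs. - int n < i \<and> i < int n"
  shows "foldr gen_act xs (tau 0 / (\<Prod>a<n. v_prod n (- int a))) =
    tau (- int n) * tau_det n (\<lambda>a. foldr simple_swap xs (- int a))"
  using assms
proof (induction xs)
  case Nil
  then show ?case using tau_det_triangular by simp
next
  case (Cons i xs)
  then have i: "- int n < i" "i < int n" by simp_all
  then have "gen_act i (tau (- int n)) = tau (- int n)" by (simp add: gen_act_var)
  then show ?case using Cons gen_act_tau_det[OF i] by (simp add: gen_act.hom_mult)
qed

section \<open>Alternating products\<close>

text \<open>Sorting the images of the pairs permutes the set of pairs and costs one sign per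
  inversion; a transposition has an odd number of inversions.\<close>

lemma prod_pairs_transpose:
  fixes e :: "nat \<Rightarrow> nat \<Rightarrow> 'a :: comm_ring_1"
  assumes anti: "\<And>i j. e i j = - e j i" and ab: "a < b" "b < n"
  shows "(\<Prod>(i, j)\<in>{(i, j). i < j \<and> j < n}. e (transpose a b i) (transpose a b j)) =
    - (\<Prod>(i, j)\<in>{(i, j). i < j \<and> j < n}. e i j)"
proof -
  define P where "P = {(i, j). i < j \<and> j < n}"
  define t where "t = transpose a b"
  have t: "t i = (if i = a then b else if i = b then a else i)" for i by (simp add: t_def transpose_def)
  have fin: "finite P" by (rule finite_subset[of _ "{..<n} \<times> {..<n}"]) (auto simp: P_def)
  define g where "g = (\<lambda>(i, j). (min (t i) (t j), max (t i) (t j)))"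
  define I where "I = {(i, j) \<in> P. t j < t i}"
  \<comment> \<open>Inverted are \<open>(a, b)\<close> and, for each \<open>m\<close> strictly
    between, \<open>(a, m)\<close> and \<open>(m, b)\<close>.\<close>
  have I: "I = insert (a, b) (Pair a ` {a<..<b} \<union> (\<lambda>m. (m, b)) ` {a<..<b})"
    using ab by (auto simp: I_def P_def t split: if_splits)
  have "card (Pair a ` {a<..<b} \<union> (\<lambda>m. (m, b)) ` {a<..<b}) = card {a<..<b} + card {a<..<b}"
    by (subst card_Un_disjoint) (auto simp: card_image inj_on_def)
  then have "card I = Suc (2 * card {a<..<b})"
    unfolding I by (subst card_insert_disjoint) auto
  then have odd: "(- 1 :: 'a) ^ card I = - 1" by simp
  have g: "g p \<in> P" "g (g p) = p" if "p \<in> P" for p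
  proof -
    from that obtain i j where p: "p = (i, j)" "i < j" "j < n" by (auto simp: P_def)
    have inv: "t (t i) = i" "t (t j) = j" by (simp_all add: t_def)
    moreover have "t i \<noteq> t j" using inv p(2) by (metis less_irrefl)
    moreover have "t i < n" "t j < n" using p ab by (simp_all add: t)
    ultimately show "g p \<in> P" "g (g p) = p"
      using p by (cases "t i < t j"; simp add: g_def P_def)+
  qed
  have "(\<Prod>(i, j)\<in>P. e (t i) (t j)) =
      (\<Prod>p\<in>P. (if p \<in> I then - 1 else 1) * (\<lambda>(i, j). e i j) (g p))"
  proof (rule prod.cong)
    fix p assume "p \<in> P"
    then show "(case p of (i, j) \<Rightarrow> e (t i) (t j)) =
        (if p \<in> I then - 1 else 1) * (\<lambda>(i, j). e i j) (g p)"
      using anti[of "t (fst p)" "t (snd p)"]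
      by (cases p; cases "t (snd p) < t (fst p)") (simp_all add: I_def g_def)
  qed simp
  also have "\<dots> = (\<Prod>p\<in>P. if p \<in> I then - 1 else 1) * (\<Prod>p\<in>P. (\<lambda>(i, j). e i j) (g p))"
    by (rule prod.distrib)
  also have "(\<Prod>p\<in>P. (\<lambda>(i, j). e i j) (g p)) = (\<Prod>(i, j)\<in>P. e i j)"
    using g by (intro prod.reindex_bij_witness[of _ g g]) auto
  also have "(\<Prod>p\<in>P. if p \<in> I then - 1 else 1 :: 'a) = (\<Prod>p\<in>I. - 1)"
    using fin by (intro prod.mono_neutral_cong_right) (auto simp: I_def)
  also have "\<dots> = - 1" by (simp add: odd)
  finally show ?thesis by (simp add: P_def t_def)
qed

lemma prod_pairs_permutes:
  fixes e :: "nat \<Rightarrow> nat \<Rightarrow> 'a :: comm_ring_1"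
  assumes "p permutes {0..<n}" and anti: "\<And>i j. e i j = - e j i"
  shows "(\<Prod>(i, j)\<in>{(i, j). i < j \<and> j < n}. e (p i) (p j)) =
    signof p * (\<Prod>(i, j)\<in>{(i, j). i < j \<and> j < n}. e i j)"
proof -
  have "finite {0..<n}" by simp
  \<comment> \<open>Quantified over \<open>e\<close>, because splitting off a transposition replaces
    \<open>e\<close> by \<open>e'\<close> in the induction hypothesis.\<close>
  with assms(1) have "\<forall>e :: nat \<Rightarrow> nat \<Rightarrow> 'a. (\<forall>i j. e i j = - e j i) \<longrightarrow>
      (\<Prod>(i, j)\<in>{(i, j). i < j \<and> j < n}. e (p i) (p j)) =
      signof p * (\<Prod>(i, j)\<in>{(i, j). i < j \<and> j < n}. e i j)"
  proof (induction p rule: permutes_induct)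
    case id
    show ?case by (intro allI impI) (simp (no_asm))
  next
    case (swap a b p)
    have "permutation p" using swap.hyps(4) by (auto simp: permutation_permutes)
    then have sign: "sign (transpose a b \<circ> p) = - sign p"
      using swap.hyps(3) by (simp add: sign_compose permutation_swap_id sign_swap_id)
    have prod: "(\<Prod>(i, j)\<in>{(i, j). i < j \<and> j < n}. e (transpose a b i) (transpose a b j)) =
        - (\<Prod>(i, j)\<in>{(i, j). i < j \<and> j < n}. e i j)"
      if "\<forall>i j. e i j = - e j i" for e :: "nat \<Rightarrow> nat \<Rightarrow> 'a"
    proof (cases "a < b")
      case True
      moreover have "b < n" using swap.hyps(2) by simp
      ultimately show ?thesis by (rule prod_pairs_transpose[OF that[rule_format]])
    next
      case False
      then have "b < a" "a < n" using swap.hyps(1,3) by simp_all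
      then show ?thesis
        unfolding transpose_commute[of a b] by (rule prod_pairs_transpose[OF that[rule_format]])
    qed
    show ?case
    proof (intro allI impI)
      fix e :: "nat \<Rightarrow> nat \<Rightarrow> 'a"
      assume e: "\<forall>i j. e i j = - e j i"
      define e' where "e' i j = e (transpose a b i) (transpose a b j)" for i j
      have e': "\<forall>i j. e' i j = - e' j i" unfolding e'_def by (intro allI e[rule_format])
      have "(\<Prod>(i, j)\<in>{(i, j). i < j \<and> j < n}. e' (p i) (p j)) =
          signof p * (\<Prod>(i, j)\<in>{(i, j). i < j \<and> j < n}. e' i j)"
        using swap.IH e' by blast
      also have "\<dots> = signof (transpose a b \<circ> p) * (\<Prod>(i, j)\<in>{(i, j). i < j \<and> j < n}. e i j)"
        unfolding sign e'_def prod[OF e] by simp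
      finally show "(\<Prod>(i, j)\<in>{(i, j). i < j \<and> j < n}. e ((transpose a b \<circ> p) i) ((transpose a b \<circ> p) j)) =
          signof (transpose a b \<circ> p) * (\<Prod>(i, j)\<in>{(i, j). i < j \<and> j < n}. e i j)"
        unfolding e'_def comp_apply .
    qed
  qed
  from this[rule_format] show ?thesis using anti .
qed

section \<open>The determinant formula\<close>

definition row_det :: "nat \<Rightarrow> (nat \<Rightarrow> int) \<Rightarrow> ratfun" where
  "row_det n y = det (mat n n (\<lambda>(a, b). row_mat (- int b) (y a)))"

lemma tau_det_eq_row_det:
  "tau_det n y = (\<Prod>a<n. tau (y a) / tau (y a - 1) / v_prod n (y a)) * row_det n y"
proof -
  let ?X = "mat n n (\<lambda>(a, b). row_mat (- int b) (y a))"
  let ?c = "\<lambda>a. tau (y a) / tau (y a - 1) / v_prod n (y a)"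
  have 1: "mat n n (\<lambda>(a, b). tau_mat (- int b) (y a) / v_prod n (y a)) =
      mat\<^sub>r n n (\<lambda>a. ?c a \<cdot>\<^sub>v row ?X a)"
    by (intro eq_matI) (auto simp: tau_mat_def)
  have 2: "mat\<^sub>r n n (\<lambda>a. row ?X a) = ?X"
    by (intro eq_matI) auto
  show ?thesis
    unfolding tau_det_def row_det_def 1
    by (subst det_rows_mul) (auto simp: 2 atLeast0LessThan)
qed

lemma row_det_permute:
  assumes "p permutes {0..<n}"
  shows "row_det n (y \<circ> p) = signof p * row_det n y"
proof -
  let ?X = "mat n n (\<lambda>(a, b). row_mat (- int b) (y a))"
  have "p i < n" if "i < n" for i using permutes_in_image[OF assms, of i] that by simp
  then have "mat n n (\<lambda>(a, b). row_mat (- int b) ((y \<circ> p) a)) = mat n n (\<lambda>(i, j). ?X $$ (p i, j))"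
    by (intro eq_matI) auto
  then show ?thesis
    unfolding row_det_def using det_permute_rows[OF _ assms, of ?X] by simp
qed

text \<open>Both factors change by the sign of the permutation, so the rows may be sorted.\<close>

lemma prod_row_det_permute:
  assumes "p permutes {0..<n}"
  shows "(\<Prod>(i, j)\<in>{(i, j). i < j \<and> j < n}. v_diff (y (p i)) (y (p j))) * row_det n (y \<circ> p) =
    (\<Prod>(i, j)\<in>{(i, j). i < j \<and> j < n}. v_diff (y i) (y j)) * row_det n y"
proof -
  have "(\<Prod>(i, j)\<in>{(i, j). i < j \<and> j < n}. v_diff (y (p i)) (y (p j))) =
      signof p * (\<Prod>(i, j)\<in>{(i, j). i < j \<and> j < n}. v_diff (y i) (y j))"
    by (rule prod_pairs_permutes[OF assms]) (rule v_diff_swap)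
  moreover have "signof p * signof p = (1 :: ratfun)"
    by (simp flip: of_int_mult)
  ultimately show ?thesis
    unfolding row_det_permute[OF assms] by (simp add: mult.left_commute mult.assoc[symmetric])
qed

lemma prod_triangle:
  fixes h :: "nat \<Rightarrow> nat \<Rightarrow> 'a :: comm_monoid_mult"
  shows "(\<Prod>j<n. \<Prod>i<j. h i j) = (\<Prod>(i, j)\<in>{(i, j). i < j \<and> j < n}. h i j)"
proof -
  have "(\<Prod>j<n. \<Prod>i<j. h i j) = (\<Prod>(j, i)\<in>(SIGMA j:{..<n}. {..<j}). h i j)"
    by (rule prod.Sigma) auto
  also have "\<dots> = (\<Prod>(i, j)\<in>{(i, j). i < j \<and> j < n}. h i j)"
    by (rule prod.reindex_bij_witness[of _ prod.swap prod.swap]) auto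
  finally show ?thesis .
qed

text \<open>In \<open>v_prod n (- int a)\<close> the indices \<open>- i\<close> with
  \<open>i < a\<close> yield the Vandermonde part; the indices from 1 to \<open>n\<close> are
  carried to the gaps, because the word permutes the window.\<close>

lemma foldr_gen_act_v_prod:
  assumes xs: "\<forall>i\<in>set xs. - int n < i \<and> i < int n"
  defines "y \<equiv> \<lambda>a. foldr simple_swap xs (- int a)"
  shows "foldr gen_act xs (\<Prod>a<n. v_prod n (- int a)) =
    (\<Prod>(i, j)\<in>{(i, j). i < j \<and> j < n}. v_diff (y i) (y j)) *
    (\<Prod>a<n. \<Prod>c\<in>{1 - int n..int n} - y ` {..<n}. v_diff c (y a))"
proof -
  interpret field_hom "foldr gen_act xs" by (rule field_hom_foldr)
  let ?s = "foldr simple_swap xs"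
  have inj: "inj ?s" using bij_foldr_swap by (rule bij_is_inj)
  have surj: "surj ?s" using bij_foldr_swap by (rule bij_is_surj)
  have U: "?s ` {1 - int n..int n} = {1 - int n..int n}"
  proof (intro equalityI subsetI)
    fix x assume x: "x \<in> {1 - int n..int n}"
    obtain z where z: "x = ?s z" using surj by auto
    then have "z \<in> {1 - int n..int n}" using x foldr_swap_in_range[OF xs, where a = z] by simp
    then show "x \<in> ?s ` {1 - int n..int n}" using z by simp
  next
    fix x assume "x \<in> ?s ` {1 - int n..int n}"
    then show "x \<in> {1 - int n..int n}"
      using foldr_swap_in_range[OF xs] by blast
  qed
  have neg: "(\<lambda>a. - int a) ` {..<n} = {1 - int n..0}"
  proof (intro equalityI subsetI)
    fix x assume "x \<in> {1 - int n..0}"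
    then show "x \<in> (\<lambda>a. - int a) ` {..<n}" by (intro image_eqI[of _ _ "nat (- x)"]) auto
  qed auto
  have "{1 - int n..int n} - {1 - int n..0} = {1..int n}" by auto
  then have C: "?s ` {1..int n} = {1 - int n..int n} - y ` {..<n}"
    using image_set_diff[OF inj, of "{1 - int n..int n}" "{1 - int n..0}"] U
    unfolding neg[symmetric] y_def image_image by simp
  have split: "{- int a<..int n} = (\<lambda>i. - int i) ` {..<a} \<union> {1..int n}" if "a < n" for a
  proof (intro equalityI subsetI)
    fix x assume x: "x \<in> {- int a<..int n}"
    show "x \<in> (\<lambda>i. - int i) ` {..<a} \<union> {1..int n}"
    proof (cases "1 \<le> x")
      case False
      then have "x = - int (nat (- x))" "nat (- x) \<in> {..<a}" using x by auto
      then show ?thesis by blast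
    qed (use x in simp)
  qed (use that in auto)
  have "foldr gen_act xs (v_prod n (- int a)) =
      (\<Prod>i<a. v_diff (y i) (y a)) * (\<Prod>c\<in>{1 - int n..int n} - y ` {..<n}. v_diff c (y a))"
    if "a < n" for a
  proof -
    have "foldr gen_act xs (v_prod n (- int a)) = (\<Prod>q\<in>{- int a<..int n}. v_diff (?s q) (y a))"
      by (simp add: v_prod_def hom_prod foldr_gen_act_v_diff y_def)
    also have "\<dots> = (\<Prod>q\<in>(\<lambda>i. - int i) ` {..<a}. v_diff (?s q) (y a)) *
        (\<Prod>q\<in>{1..int n}. v_diff (?s q) (y a))"
      unfolding split[OF that] by (rule prod.union_disjoint) auto
    also have "(\<Prod>q\<in>(\<lambda>i. - int i) ` {..<a}. v_diff (?s q) (y a)) = (\<Prod>i<a. v_diff (y i) (y a))"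
      by (subst prod.reindex) (auto simp: inj_on_def y_def)
    also have "(\<Prod>q\<in>{1..int n}. v_diff (?s q) (y a)) =
        (\<Prod>c\<in>?s ` {1..int n}. v_diff c (y a))"
      by (subst prod.reindex) (use inj in \<open>auto intro: inj_on_subset\<close>)
    finally show ?thesis unfolding C .
  qed
  then have "foldr gen_act xs (\<Prod>a<n. v_prod n (- int a)) =
      (\<Prod>a<n. (\<Prod>i<a. v_diff (y i) (y a)) * (\<Prod>c\<in>{1 - int n..int n} - y ` {..<n}. v_diff c (y a)))"
    unfolding hom_prod by (intro prod.cong) auto
  then show ?thesis by (simp only: prod.distrib prod_triangle)
qed

lemma maya_abs:
  assumes xs: "\<forall>i\<in>set xs. - int n < i \<and> i < int n"
  defines "y \<equiv> \<lambda>a. foldr simple_swap xs (- int a)"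
  shows "maya (abs_weyl xs) = {..- int n} \<union> y ` {..<n}" "y ` {..<n} \<subseteq> {1 - int n..int n}" "inj_on y A"
proof -
  have fixed: "foldr simple_swap xs a = a" if "a \<notin> {1 - int n..int n}" for a
    using xs that by (rule foldr_swap_fixed)
  have "{..0} = {..- int n} \<union> (\<lambda>a. - int a) ` {..<n}"
  proof (intro equalityI subsetI)
    fix x :: int assume x: "x \<in> {..0}"
    show "x \<in> {..- int n} \<union> (\<lambda>a. - int a) ` {..<n}"
    proof (cases "x \<le> - int n")
      case False
      then have "x = - int (nat (- x))" "nat (- x) \<in> {..<n}" using x by auto
      then show ?thesis by blast
    qed simp
  qed auto
  then have "maya (abs_weyl xs) = foldr simple_swap xs ` {..- int n} \<union> y ` {..<n}"
    by (simp add: maya_def weyl_perm_abs image_Un image_image y_def)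
  also have "foldr simple_swap xs ` {..- int n} = {..- int n}"
    using fixed by (intro image_cong[where g = id and N = "{..- int n}", simplified]) auto
  finally show "maya (abs_weyl xs) = {..- int n} \<union> y ` {..<n}" .
  have "y a \<in> {1 - int n..int n}" if "a < n" for a
    unfolding y_def by (subst foldr_swap_in_range) (use xs that in auto)
  then show "y ` {..<n} \<subseteq> {1 - int n..int n}" by blast
  have "inj (foldr simple_swap xs)" using bij_foldr_swap by (rule bij_is_inj)
  show "inj_on y A"
  proof (rule inj_onI)
    show "a = b" if "y a = y b" for a b
      using injD[OF \<open>inj (foldr simple_swap xs)\<close>, of "- int a" "- int b"] that by (simp add: y_def)
  qed
qed

text \<open>Above \<open>x a\<close> the window contains the earlier \<open>x i\<close> and the gaps
  above \<open>x a\<close>. In \<open>foldr_gen_act_v_prod\<close> all gaps occur; the quotient will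
  leave those below.\<close>

lemma prod_v_prod:
  assumes dec: "\<And>i j. i < j \<Longrightarrow> j < n \<Longrightarrow> x j < x i" and range: "x ` {..<n} \<subseteq> {1 - int n..int n}"
  shows "(\<Prod>a<n. v_prod n (x a)) = (\<Prod>(i, j)\<in>{(i, j). i < j \<and> j < n}. v_diff (x i) (x j)) *
    (\<Prod>a<n. \<Prod>c\<in>{c \<in> {1 - int n..int n} - x ` {..<n}. x a < c}. v_diff c (x a))"
proof -
  let ?C = "\<lambda>a. {c \<in> {1 - int n..int n} - x ` {..<n}. x a < c}"
  have "v_prod n (x a) = (\<Prod>i<a. v_diff (x i) (x a)) * (\<Prod>c\<in>?C a. v_diff c (x a))"
    if a: "a < n" for a
  proof -
    have less_iff: "x a < x i \<longleftrightarrow> i < a" if "i < n" for i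
      using dec[of i a] dec[of a i] a that by (cases i a rule: linorder_cases) auto
    have "{x a<..int n} = x ` {..<a} \<union> ?C a"
    proof (intro equalityI subsetI)
      fix q assume q: "q \<in> {x a<..int n}"
      have "x a \<in> {1 - int n..int n}" using range a by blast
      then show "q \<in> x ` {..<a} \<union> ?C a"
        using q less_iff by (cases "q \<in> x ` {..<n}") auto
    next
      fix q assume "q \<in> x ` {..<a} \<union> ?C a"
      then show "q \<in> {x a<..int n}"
      proof
        assume "q \<in> x ` {..<a}"
        then obtain i where "i < a" "q = x i" by auto
        then show ?thesis using range a less_iff[of i] by fastforce
      qed simp
    qed
    moreover have "(\<Prod>q\<in>x ` {..<a} \<union> ?C a. v_diff q (x a)) =
        (\<Prod>q\<in>x ` {..<a}. v_diff q (x a)) * (\<Prod>c\<in>?C a. v_diff c (x a))"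
      using a by (intro prod.union_disjoint finite_subset[of "?C a" "{1 - int n..int n}"]) auto
    moreover have "inj_on x {..<a}"
    proof (rule linorder_inj_onI)
      show "x i \<noteq> x j" if "i < j" "i \<in> {..<a}" "j \<in> {..<a}" for i j
        using dec[of i j] that a by simp
    qed auto
    ultimately show ?thesis
      by (simp only: v_prod_def prod.reindex comp_def)
  qed
  then have "(\<Prod>a<n. v_prod n (x a)) =
      (\<Prod>a<n. (\<Prod>i<a. v_diff (x i) (x a)) * (\<Prod>c\<in>?C a. v_diff c (x a)))"
    by (intro prod.cong) auto
  then show ?thesis by (simp only: prod.distrib prod_triangle)
qed

text \<open>After sorting, the Vandermonde products cancel; so do the gaps above each element, and
  the gaps below remain as the normalization factor.\<close>

lemma phi_norm_word:
  assumes xs: "\<forall>i\<in>set xs. - int n < i \<and> i < int n"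
  shows "phi_norm (abs_weyl xs) = row_det n (\<lambda>a. row_pos (partition_of (abs_weyl xs)) (Suc a))"
proof -
  define y where "y a = foldr simple_swap xs (- int a)" for a
  define lam where "lam = partition_of (abs_weyl xs)"
  define x where "x a = row_pos lam (Suc a)" for a
  define U where "U = {1 - int n..int n}"
  define S where "S = y ` {..<n}"
  note maya = maya_abs[OF xs, folded y_def S_def U_def]
  have cardS: "card S = n" using maya(3)[of "{..<n}"] by (simp add: S_def card_image)
  note part = partition_of_maya[OF maya(1) maya(2)[unfolded U_def] cardS, folded lam_def]
  have xS: "x ` {..<n} = S"
    using part(4) unfolding x_def image_Suc_lessThan[symmetric] image_image .
  have dec: "x j < x i" if "i < j" for i j
    using row_pos_less[OF part(1), of "Suc i" "Suc j"] that by (simp add: x_def)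
  have injx: "inj_on x {..<n}"
  proof (rule linorder_inj_onI)
    show "x i \<noteq> x j" if "i < j" for i j using dec[OF that] by simp
  qed auto
  \<comment> \<open>The permutation between the order \<open>y\<close> produced by the word and the
    decreasing order \<open>x\<close>; it must be the identity from \<open>n\<close> on to satisfy
    \<open>permutes\<close>.\<close>
  define p where "p a = (if a < n then the_inv_into {..<n} x (y a) else a)" for a
  have "bij_betw x {..<n} S" using injx xS by (simp add: bij_betw_def)
  then have "bij_betw (the_inv_into {..<n} x) S {..<n}" by (rule bij_betw_the_inv_into)
  moreover have "bij_betw y {..<n} S" using maya(3)[of "{..<n}"] by (simp add: bij_betw_def S_def)
  ultimately have "bij_betw (the_inv_into {..<n} x \<circ> y) {..<n} {..<n}" by (rule bij_betw_trans[rotated])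
  then have "bij_betw p {..<n} {..<n}"
    by (rule bij_betw_cong[THEN iffD1, rotated]) (simp add: p_def)
  then have "p permutes {..<n}" by (rule bij_imp_permutes) (simp add: p_def)
  then have p: "p permutes {0..<n}" by (simp add: atLeast0LessThan)
  have yx: "y a = x (p a)" if "a < n" for a
    using that injx xS f_the_inv_into_f[of x "{..<n}" "y a"] by (auto simp: p_def S_def)
  \<comment> \<open>\<open>?V\<close> is the Vandermonde product; \<open>?R\<close> takes all gaps,
    \<open>?G\<close> those above and \<open>?L\<close> those below each element.\<close>
  let ?V = "\<lambda>y. \<Prod>(i, j)\<in>{(i, j). i < j \<and> j < n}. v_diff (y i) (y j)"
  let ?R = "\<Prod>m\<in>S. \<Prod>c\<in>U - S. v_diff c m"
  let ?G = "\<Prod>m\<in>S. \<Prod>c\<in>{c \<in> U - S. m < c}. v_diff c m"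
  let ?L = "\<Prod>m\<in>S. \<Prod>c\<in>{c \<in> U - S. c < m}. v_diff c m"
  let ?T = "\<Prod>a<n. tau (y a) / tau (y a - 1)"
  have finS: "finite S" by (simp add: S_def)
  have finU: "finite U" by (simp add: U_def)
  have VD: "?V y * row_det n y = ?V x * row_det n x"
  proof -
    have "?V y = ?V (x \<circ> p)" by (intro prod.cong) (auto simp: yx)
    moreover have "row_det n y = row_det n (x \<circ> p)"
      unfolding row_det_def by (intro arg_cong[of _ _ det] eq_matI) (auto simp: yx)
    ultimately show ?thesis using prod_row_det_permute[OF p, of x] by simp
  qed
  have v_ne: "(\<Prod>a<n. v_prod n (z a)) \<noteq> 0" for z by (simp add: v_prod_nonzero)
  have sumS: "(\<Prod>a<n. h (y a)) = (\<Prod>m\<in>S. h m)" for h :: "int \<Rightarrow> ratfun"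
    using maya(3)[of "{..<n}"] by (simp add: S_def prod.reindex)
  have sumS': "(\<Prod>a<n. h (x a)) = (\<Prod>m\<in>S. h m)" for h :: "int \<Rightarrow> ratfun"
    unfolding xS[symmetric] using injx by (simp add: prod.reindex)
  have RG: "?R = ?G * ?L"
  proof -
    have "(\<Prod>c\<in>U - S. v_diff c m) =
        (\<Prod>c\<in>{c \<in> U - S. m < c}. v_diff c m) * (\<Prod>c\<in>{c \<in> U - S. c < m}. v_diff c m)" if "m \<in> S" for m
    proof -
      have "m < c \<or> c < m" if "c \<in> U - S" for c
        using that \<open>m \<in> S\<close> by (cases c m rule: linorder_cases) auto
      then have "U - S = {c \<in> U - S. m < c} \<union> {c \<in> U - S. c < m}" by blast
      then have "(\<Prod>c\<in>U - S. v_diff c m) =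
          (\<Prod>c\<in>{c \<in> U - S. m < c} \<union> {c \<in> U - S. c < m}. v_diff c m)"
        by (rule arg_cong)
      also have "\<dots> = (\<Prod>c\<in>{c \<in> U - S. m < c}. v_diff c m) * (\<Prod>c\<in>{c \<in> U - S. c < m}. v_diff c m)"
        using finU by (intro prod.union_disjoint) auto
      finally show ?thesis .
    qed
    then show ?thesis unfolding prod.distrib[symmetric] by (rule prod.cong[OF refl])
  qed
  have P: "(\<Prod>a<n. v_prod n (y a)) = ?V x * ?G"
  proof -
    \<comment> \<open>The product depends only on the set \<open>S\<close>, so it may be evaluated
      along the decreasing enumeration.\<close>
    have "(\<Prod>a<n. v_prod n (y a)) = (\<Prod>a<n. v_prod n (x a))" unfolding sumS[of "v_prod n"] sumS'[of "v_prod n"] ..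
    also have "\<dots> = ?V x * (\<Prod>a<n. \<Prod>c\<in>{c \<in> U - S. x a < c}. v_diff c (x a))"
      unfolding U_def xS[symmetric] using maya(2) by (intro prod_v_prod dec) (simp_all add: xS U_def)
    finally show ?thesis unfolding sumS'[of "\<lambda>m. \<Prod>c\<in>{c \<in> U - S. m < c}. v_diff c m"] .
  qed
  have ne: "?V x \<noteq> 0" "?G \<noteq> 0" using v_ne[of y] unfolding P by simp_all
  have N: "norm_factor lam = ?L"
  proof -
    have "norm_factor lam = (\<Prod>(m, c)\<in>{(m, c) \<in> S \<times> (U - S). c < m}. v_diff c m)"
      unfolding U_def using norm_factor_eq[OF part(1-3)] unfolding part(4) .
    also have "{(m, c) \<in> S \<times> (U - S). c < m} = (SIGMA m:S. {c \<in> U - S. c < m})" by auto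
    also have "(\<Prod>(m, c)\<in>(SIGMA m:S. {c \<in> U - S. c < m}). v_diff c m) = ?L"
      using finS finU by (intro prod.Sigma[symmetric]) auto
    finally show ?thesis .
  qed
  have N_ne: "norm_factor lam \<noteq> 0"
    unfolding N using finS finU by (auto simp: v_diff_nonzero)
  interpret field_hom "foldr gen_act xs" by (rule field_hom_foldr)
  have "foldr gen_act xs (\<Prod>a<n. v_prod n (- int a)) = ?V y * ?R"
    using foldr_gen_act_v_prod[OF xs, folded y_def S_def U_def] sumS[of "\<lambda>m. \<Prod>c\<in>U - S. v_diff c m"]
    by simp
  moreover have "foldr gen_act xs (tau 0 / (\<Prod>a<n. v_prod n (- int a))) = tau (- int n) * tau_det n y"
    using foldr_gen_act_tau[OF xs] by (simp add: y_def[abs_def])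
  ultimately have "foldr gen_act xs (tau 0) = ?V y * ?R * (tau (- int n) * tau_det n y)"
    using v_ne[of "\<lambda>a. - int a"] hom_0_iff[of "\<Prod>a<n. v_prod n (- int a)"] by (simp add: hom_div field_simps)
  also have "tau_det n y = ?T / (\<Prod>a<n. v_prod n (y a)) * row_det n y"
    unfolding tau_det_eq_row_det by (simp only: prod_dividef)
  finally have act: "foldr gen_act xs (tau 0) =
      ?V y * ?R * (tau (- int n) * (?T / (\<Prod>a<n. v_prod n (y a)) * row_det n y))" .
  have "?T \<noteq> 0" by simp
  have "phi (abs_weyl xs) = foldr gen_act xs (tau 0) / (tau (- int n) * ?T)"
    using phi_eq_divide[OF xs] by (simp add: y_def[abs_def])
  also have "\<dots> = (?V y * row_det n y) * ?R / (\<Prod>a<n. v_prod n (y a))"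
    unfolding act using \<open>?T \<noteq> 0\<close> by simp
  also have "\<dots> = norm_factor lam * row_det n x"
    unfolding VD P RG N using ne by simp
  finally show ?thesis
    unfolding phi_norm_def lam_def[symmetric] using N_ne by (simp add: x_def[abs_def])
qed

text \<open>Rows beyond the length of the partition only contribute a unitriangular block.\<close>

lemma row_det_length:
  assumes "length lam \<le> n"
  shows "row_det n (\<lambda>a. row_pos lam (Suc a)) = row_det (length lam) (\<lambda>a. row_pos lam (Suc a))"
proof -
  define l where "l = length lam"
  define m where "m = n - l"
  have n: "n = l + m" using assms by (simp add: m_def l_def)
  let ?e = "\<lambda>a b. row_mat (- int b) (row_pos lam (Suc a))"
  let ?A = "mat l l (\<lambda>(a, b). ?e a b)" and ?B = "mat l m (\<lambda>(a, b). ?e a (l + b))"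
    and ?D = "mat m m (\<lambda>(a, b). ?e (l + a) (l + b))"
  \<comment> \<open>Counted from zero, row \<open>a\<close> beyond the length has position
    \<open>- a\<close>, so its entries vanish before the diagonal and equal one on it.\<close>
  have pos: "row_pos lam (Suc (l + a)) = - int (l + a)" for a
    by (simp add: row_pos_def part_def l_def)
  have "mat n n (\<lambda>(a, b). ?e a b) = four_block_mat ?A ?B (0\<^sub>m m l) ?D"
  proof (rule eq_matI)
    fix a b
    assume ab: "a < dim_row (four_block_mat ?A ?B (0\<^sub>m m l) ?D)"
      "b < dim_col (four_block_mat ?A ?B (0\<^sub>m m l) ?D)"
    show "mat n n (\<lambda>(a, b). ?e a b) $$ (a, b) = four_block_mat ?A ?B (0\<^sub>m m l) ?D $$ (a, b)"
    proof (cases "a < l")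
      case False
      then have "a = l + (a - l)" by simp
      then have "row_pos lam (Suc a) = - int a" using pos[of "a - l"] by simp
      then show ?thesis using ab False by (auto simp: n row_mat_below)
    qed (use ab in \<open>auto simp: n\<close>)
  qed (simp_all add: n)
  then have "row_det n (\<lambda>a. row_pos lam (Suc a)) = det ?A * det ?D"
    unfolding row_det_def by (simp add: det_four_block_mat_lower_left_zero[of _ l _ m])
  also have "det ?D = prod_list (diag_mat ?D)"
    by (rule det_upper_triangular[of _ m]) (auto simp: pos row_mat_below)
  also have "\<dots> = 1"
    unfolding prod_list_diag_prod by (simp add: pos row_mat_diag)
  finally show ?thesis by (simp add: row_det_def l_def)
qed

text \<open>Any window containing the letters of a representing word gives the formula;
  \<open>row_det_length\<close> then removes the dependence on the window.\<close>

lemma phi_norm_eq_row_det: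
  "phi_norm w = row_det (length (partition_of w)) (\<lambda>a. row_pos (partition_of w) (Suc a))"
proof -
  obtain xs where w: "w = abs_weyl xs" using Quotient_abs_rep[OF Quotient_weyl] by metis
  define n where "n = Suc (Max (insert 0 ((\<lambda>i. nat \<bar>i\<bar>) ` set xs)))"
  have xs: "\<forall>i\<in>set xs. - int n < i \<and> i < int n"
  proof
    fix i assume "i \<in> set xs"
    then have "nat \<bar>i\<bar> \<le> Max (insert 0 ((\<lambda>i. nat \<bar>i\<bar>) ` set xs))" by (intro Max_ge) auto
    then have "nat \<bar>i\<bar> < n" unfolding n_def by (rule le_imp_less_Suc)
    then show "- int n < i \<and> i < int n" by linarith
  qed
  have "card ((\<lambda>a. foldr simple_swap xs (- int a)) ` {..<n}) = n"
    by (simp add: card_image[OF maya_abs(3)[OF xs]])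
  then have "length (partition_of w) \<le> n"
    unfolding w by (rule partition_of_maya(2)[OF maya_abs(1,2)[OF xs]])
  then show ?thesis
    using phi_norm_word[OF xs] unfolding w by (simp only: row_det_length[of _ n])
qed

section \<open>Single rows\<close>

lemma row_elt_abs: "row_elt k = abs_weyl (map int (rev [0..<k]))"
proof -
  have "prod_list (map weyl_s is) = abs_weyl is" for "is"
    by (induction "is") (simp_all add: one_weyl.abs_eq weyl_s.abs_eq times_weyl.abs_eq)
  from this[of "map int (rev [0..<k])"] show ?thesis unfolding row_elt_def by (simp only: map_map comp_def)
qed

lemma maya_row_elt: "maya (row_elt k) = insert (int k) {..- 1}"
proof -
  have 0: "foldr simple_swap (map int (rev [0..<k])) 0 = int k"
    by (induction k) (simp_all add: simple_swap_apply)
  have "foldr simple_swap (map int (rev [0..<k])) j = j" if "j \<le> - 1" for j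
    using that by (induction k) (simp_all add: simple_swap_apply)
  then have "foldr simple_swap (map int (rev [0..<k])) ` {..- 1} = {..- 1}"
    by (intro image_cong[where g = id and N = "{..- 1}", simplified]) auto
  moreover have "{..0} = insert 0 {..- 1 :: int}" by auto
  ultimately show ?thesis
    unfolding maya_def row_elt_abs weyl_perm_abs by (simp only: image_insert 0)
qed

lemma partition_of_row_elt:
  assumes "0 < k"
  shows "partition_of (row_elt k) = [k]"
proof (rule partition_of_eqI)
  show "is_partition [k]" using assms by (simp add: is_partition_def)
  have "{..- int 1} = {..- 1 :: int}" by simp
  then show "row_pos [k] ` {1..} = maya (row_elt k)"
    using row_pos_image_atLeast[of "[k]" 1] by (simp add: maya_row_elt row_pos_def part_def)
qed

text \<open>For one row the determinant is 1 by 1, which identifies \<open>row_fun\<close> with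
  \<open>h\<close> at upper index 0.\<close>

lemma phi_norm_row_elt:
  assumes "0 < k"
  shows "phi_norm (row_elt k) = row_fun 0 k"
  unfolding phi_norm_eq_row_det partition_of_row_elt[OF assms] row_det_def
  by (subst det_single) (simp_all add: row_mat_def row_pos_def part_def)

section \<open>Powers of \<open>pi_act\<close> as index shifts\<close>

lemma shift_compose: "subst (shift_image j) (subst (shift_image k) z) = subst (shift_image (j + k)) z"
proof -
  have "subst (shift_image j) \<circ> subst (shift_image k) = subst (shift_image (j + k))"
  proof (rule field_hom_ext)
    show "(subst (shift_image j) \<circ> subst (shift_image k)) (var x) = subst (shift_image (j + k)) (var x)" for x
      by (cases x) (simp_all add: subst_var add.commute add.left_commute)
  qed (intro field_hom_comp field_hom_shift | simp add: subst_const)+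
  then show ?thesis by (simp add: fun_eq_iff)
qed

lemma shift_zero: "subst (shift_image 0) z = z"
proof -
  have "shift_image 0 = var"
  proof
    show "shift_image 0 x = var x" for x by (cases x) simp_all
  qed
  then show ?thesis by (simp add: subst_id)
qed

lemma pi_power_eq: "pi_power j = subst (shift_image j)"
proof -
  have pow: "(subst (shift_image j) ^^ m) = subst (shift_image (int m * j))" for j m
    by (induction m) (simp_all add: fun_eq_iff shift_compose shift_zero distrib_right)
  have "inv_into UNIV pi_act = subst (shift_image (- 1))"
    by (rule inv_equality) (simp_all add: pi_act_def shift_compose shift_zero)
  then show ?thesis
    by (simp add: pi_power_def pi_act_def pow)
qed

text \<open>The shift renames the generators; both sides are field homomorphisms, so it suffices to
  compare them on constants and variables.\<close>

lemma shift_gen_act: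
  "subst (shift_image k) (gen_act i z) = gen_act (i + k) (subst (shift_image k) z)"
proof -
  interpret field_hom "subst (shift_image k)" by (rule field_hom_shift)
  have "subst (shift_image k) \<circ> gen_act i = gen_act (i + k) \<circ> subst (shift_image k)"
  proof (rule field_hom_ext)
    show "(subst (shift_image k) \<circ> gen_act i) (var x) = (gen_act (i + k) \<circ> subst (shift_image k)) (var x)" for x
      by (cases x) (auto simp: gen_act_var subst_var hom_add hom_minus hom_uminus hom_mult hom_div algebra_simps)
  qed (intro field_hom_comp field_hom_shift field_hom_gen | simp add: subst_const gen_act_const)+
  then show ?thesis by (simp add: fun_eq_iff)
qed

lemma shift_row_fun: "subst (shift_image j) (row_fun b k) = row_fun (b + j) k"
proof -
  interpret field_hom "subst (shift_image j)" by (rule field_hom_shift)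
  show ?thesis
    by (induction k) (simp_all add: hom_mult hom_div subst_var shift_gen_act add.commute add.left_commute)
qed

text \<open>The conventions for \<open>k \<le> 0\<close> are exactly the unitriangularity of
  \<open>row_mat\<close>.\<close>

lemma h_row_eq_row_mat: "h_row j k = row_mat j (j + k)"
  by (simp add: h_row_def row_mat_def pi_power_eq phi_norm_row_elt shift_row_fun)

theorem theorem2:
  fixes w :: weyl
  shows "let lam = partition_of w; l = length lam in
    phi_norm w =
      det (mat l l (\<lambda>(a, b). let i = Suc a; j = Suc b in
        h_row (1 - int j) (int (part lam i) - int i + int j)))"
  \<comment> \<open>With \<open>j = b + 1\<close> the upper index is \<open>- b\<close>, and upper
    and lower index add up to \<open>row_pos lam i\<close>, independently of
    \<open>j\<close>.\<close>
  unfolding Let_def phi_norm_eq_row_det row_det_def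
  by (intro arg_cong[of _ _ det] eq_matI) (auto simp: h_row_eq_row_mat row_pos_def intro!: arg_cong[of _ _ "row_mat _"])

end
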